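(* Let $d, k, \ell$ be integers with $2 \le k \le d+1$ and $1 \le \ell < k$. Then there exists a constant $C = C(d) > 0$ such that for all positive integers $n, n'$ with $n' > C n$ we have $$\Delta_{k, d}(n') \le C\, \Delta_{\ell, d}(n)\, \Delta_{k-\ell, d-\ell}(n).$$
   Context: For integers $1 \le k \le d+1$ and $n \ge k$, $\Delta_{k,d}(n)$ denotes the minimum $\Delta > 0$ such that among any $n$ (distinct) points in $[0,1]^d$ there are $k$ points which form a simplex with $(k-1)$-dimensional volume at most $\Delta$ (the simplex is the convex hull of the $k$ points; if it is degenerate its volume is $0$). Conventions: the $0$-dimensional volume of a point is $1$, so $\Delta_{1,d}(n) = 1$ for all $n \ge 1$ and all $d \ge 0$ (including $d=0$); and $\Delta_{k,d}(n) = +\infty$ if $n < k$. *)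

theory Defs
  imports "HOL-Analysis.Analysis"
begin

text \<open>
  Since the ambient dimension varies inside the statement, \<open>\<real>\<^sup>d\<close> is the set
  \<open>{..<d} \<rightarrow>\<^sub>E UNIV\<close> of extensional functions, which is also the space of the product
  measure \<open>\<Pi>\<^sub>M i\<in>{..<d}. lborel\<close>, i.e. Lebesgue measure on \<open>\<real>\<^sup>d\<close>.
\<close>

definition cube :: "nat \<Rightarrow> (nat \<Rightarrow> real) set" where
  "cube d = {..<d} \<rightarrow>\<^sub>E {0..1}"

text \<open>Convex hull of a finite set of points of \<open>\<real>\<^sup>d\<close>.\<close>

definition spanned_simplex :: "nat \<Rightarrow> (nat \<Rightarrow> real) set \<Rightarrow> (nat \<Rightarrow> real) set" where
  "spanned_simplex d K = {(\<lambda>i\<in>{..<d}. \<Sum>p\<in>K. u p * p i) | u.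
                    (\<forall>p\<in>K. 0 \<le> u p) \<and> (\<Sum>p\<in>K. u p) = (1::real)}"

definition orthonormal :: "nat \<Rightarrow> nat \<Rightarrow> (nat \<Rightarrow> nat \<Rightarrow> real) \<Rightarrow> bool" where
  "orthonormal d m e \<longleftrightarrow>
     (\<forall>j<m. \<forall>j'<m. (\<Sum>i<d. e j i * e j' i) = (if j = j' then 1 else 0))"

text \<open>
  For orthonormal \<open>e\<close>, the isometric parametrization \<open>t \<mapsto> a + \<Sum>j<m. t\<^sub>j e\<^sub>j\<close> of an
  \<open>m\<close>-dimensional affine subspace of \<open>\<real>\<^sup>d\<close>.
\<close>

definition flat_map :: "nat \<Rightarrow> nat \<Rightarrow> (nat \<Rightarrow> real) \<times> (nat \<Rightarrow> nat \<Rightarrow> real) \<Rightarrow> (nat \<Rightarrow> real) \<Rightarrow> nat \<Rightarrow> real"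
  where "flat_map d m = (\<lambda>(a, e) t. \<lambda>i\<in>{..<d}. a i + (\<Sum>j<m. t j * e j i))"

definition flat_frame ::
  "nat \<Rightarrow> nat \<Rightarrow> (nat \<Rightarrow> real) set \<Rightarrow> (nat \<Rightarrow> real) \<times> (nat \<Rightarrow> nat \<Rightarrow> real) \<Rightarrow> bool" where
  "flat_frame d m S F \<longleftrightarrow>
     orthonormal d m (snd F) \<and> S \<subseteq> flat_map d m F ` ({..<m} \<rightarrow>\<^sub>E UNIV)"

text \<open>
  The \<open>m\<close>-dimensional volume of a subset \<open>S\<close> of \<open>\<real>\<^sup>d\<close> lying in some \<open>m\<close>-dimensional affine
  subspace: the Lebesgue measure of \<open>S\<close> in orthonormal coordinates of such a subspace.
  The choice of subspace and coordinates is immaterial: Lebesgue measure is invariant under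
  isometries, and if \<open>S\<close> lies in two different \<open>m\<close>-dimensional affine subspaces, its volume is 0
  in either.
\<close>

definition flat_volume :: "nat \<Rightarrow> nat \<Rightarrow> (nat \<Rightarrow> real) set \<Rightarrow> ennreal" where
  "flat_volume d m S =
     (let F = (SOME F. flat_frame d m S F)
      in emeasure (\<Pi>\<^sub>M j\<in>{..<m}. lborel) {t \<in> {..<m} \<rightarrow>\<^sub>E UNIV. flat_map d m F t \<in> S})"

definition simplex_volume :: "nat \<Rightarrow> (nat \<Rightarrow> real) set \<Rightarrow> ennreal" where
  "simplex_volume d K = flat_volume d (card K - 1) (spanned_simplex d K)"

lemma simplex_volume_singleton:
  assumes "p \<in> {..<d} \<rightarrow>\<^sub>E UNIV"
  shows "simplex_volume d {p} = 1"
proof -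
  have S: "spanned_simplex d {p} = {p}"
    using assms by (auto simp: spanned_simplex_def PiE_iff extensional_restrict intro!: exI[of _ "\<lambda>_. 1"])
  define F where "F = (SOME F. flat_frame d 0 {p} F)"
  have "flat_frame d 0 {p} (p, \<lambda>_ _. 0)"
    using assms by (auto simp: flat_frame_def orthonormal_def flat_map_def PiE_iff extensional_restrict)
  then have "flat_frame d 0 {p} F"
    unfolding F_def by (rule someI)
  then have "{t \<in> {..<0} \<rightarrow>\<^sub>E UNIV. flat_map d 0 F t \<in> {p}} = {\<lambda>_. undefined}"
    by (auto simp: flat_frame_def)
  then show ?thesis
    using S by (simp add: simplex_volume_def flat_volume_def F_def[symmetric] PiM_empty)
qed

text \<open>
  For \<open>2 \<le> k \<le> d + 1\<close> and \<open>n \<ge> k\<close> the infimum is a minimum: the condition is upward closed and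
  passes to the infimum since each \<open>P\<close> has only finitely many subsets \<open>K\<close>, and the infimum is
  positive because there are \<open>n\<close> points of the cube in general position.
  The case \<open>k = 1\<close> is separate only because \<open>[0,1]\<^sup>0\<close> does not contain \<open>n \<ge> 2\<close> distinct points.
\<close>

definition heilbronn :: "nat \<Rightarrow> nat \<Rightarrow> nat \<Rightarrow> ennreal" where
  "heilbronn k d n =
     (if n < k then \<infinity>
      else if k = 1 then 1
      else Inf {\<delta>. 0 < \<delta> \<and>
             (\<forall>P. P \<subseteq> cube d \<and> finite P \<and> card P = n \<longrightarrow>
                (\<exists>K. K \<subseteq> P \<and> card K = k \<and> simplex_volume d K \<le> \<delta>))})"

end

theory Submission
  imports Defs "HOL-Computational_Algebra.Polynomial"
begin

text \<open>
  The volume of a simplex is, up to a factor depending only on its dimension, the product of the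
  distances of each vertex from the affine span of the vertices before it (base times height,
  iterated). List the \<open>l\<close> vertices of a thin simplex \<open>L\<close> first, followed by \<open>k - l\<close> further
  points. The first \<open>l - 1\<close> distances multiply to the volume of \<open>L\<close> up to the factor; the others only see the
  components of the further points orthogonal to \<open>L\<close>, a configuration of \<open>k - l\<close> vectors in
  \<open>\<real>\<^sup>d\<^sup>-\<^sup>l\<^sup>+\<^sup>1\<close>. Project these vectors radially from the origin to a face of a cube
  around it. The faces are copies of a \<open>(d - l)\<close>-dimensional cube, and since the
  vectors are bounded, the distances of the vectors from the linear spans of their predecessors are
  at most a constant times the distances of the projected points from the affine spans of theirs.
  The product of the latter is, again up to a factor, the volume of a simplex with \<open>k - l\<close>
  vertices in dimension \<open>d - l\<close>.

  So, given \<open>n' > C n\<close> points, choose a thin \<open>L\<close> among \<open>n\<close> of them. By the pigeonhole principle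
  (opposite faces are identified) \<open>n\<close> of the remaining points project to the same face, and
  \<open>k - l\<close> of the projected points span a thin simplex. If two of these coincide, or if one of the
  chosen points lies in the affine span of \<open>L\<close>, some
  distance and hence the volume of the big simplex vanishes.

  The distances are the lengths of the vectors produced by the Gram-Schmidt process.
  Lemma \<open>simplex_volume_eq_heights\<close> identifies the volume with their product, lemma
  \<open>radial_projection_heights\<close> is the comparison under radial projection, and lemma
  \<open>thin_extension\<close> combines the two. If \<open>n < l\<close> or \<open>n < k - l\<close>, the right-hand side contains
  the factor \<open>\<infinity>\<close>, and the inequality requires that the other factor is positive. This is lemma
  \<open>heilbronn_pos\<close>; points on the moment curve are the witness.
\<close>

section \<open>Euclidean inner product and orthonormal families\<close>

definition ip :: "nat \<Rightarrow> (nat \<Rightarrow> real) \<Rightarrow> (nat \<Rightarrow> real) \<Rightarrow> real" where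
  "ip d a b = (\<Sum>x<d. a x * b x)"

lemma ip_commute: "ip d a b = ip d b a"
  by (simp add: ip_def mult.commute)

lemma ip_cong: "(\<And>x. x < d \<Longrightarrow> a x = a' x) \<Longrightarrow> (\<And>x. x < d \<Longrightarrow> b x = b' x) \<Longrightarrow> ip d a b = ip d a' b'"
  by (simp add: ip_def)

lemma ip_add_left: "ip d (\<lambda>x. a x + b x) c = ip d a c + ip d b c"
  by (simp add: ip_def algebra_simps sum.distrib)

lemma ip_diff_left: "ip d (\<lambda>x. a x - b x) c = ip d a c - ip d b c"
  by (simp add: ip_def algebra_simps sum_subtractf)

lemma ip_scale_left: "ip d (\<lambda>x. r * a x) c = r * ip d a c"
  by (simp add: ip_def algebra_simps sum_distrib_left)

lemma ip_sum_left: "ip d (\<lambda>x. \<Sum>j\<in>J. b j * a j x) c = (\<Sum>j\<in>J. b j * ip d (a j) c)"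
proof -
  have "ip d (\<lambda>x. \<Sum>j\<in>J. b j * a j x) c = (\<Sum>x<d. \<Sum>j\<in>J. b j * (a j x * c x))"
    by (simp add: ip_def sum_distrib_right mult.assoc)
  also have "\<dots> = (\<Sum>j\<in>J. b j * ip d (a j) c)"
    by (subst sum.swap) (simp add: ip_def sum_distrib_left)
  finally show ?thesis .
qed

lemma ip_add_right: "ip d c (\<lambda>x. a x + b x) = ip d c a + ip d c b"
  by (subst (1 2 3) ip_commute) (rule ip_add_left)

lemma ip_diff_right: "ip d c (\<lambda>x. a x - b x) = ip d c a - ip d c b"
  by (subst (1 2 3) ip_commute) (rule ip_diff_left)

lemma ip_scale_right: "ip d c (\<lambda>x. r * a x) = r * ip d c a"
  by (subst (1 2) ip_commute) (rule ip_scale_left)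

lemma ip_sum_right: "ip d c (\<lambda>x. \<Sum>j\<in>J. b j * a j x) = (\<Sum>j\<in>J. b j * ip d c (a j))"
  by (subst (1 2) ip_commute) (rule ip_sum_left)

lemmas ip_linear = ip_add_left ip_diff_left ip_scale_left ip_sum_left
  ip_add_right ip_diff_right ip_scale_right ip_sum_right

lemma ip_self_nonneg [simp]: "0 \<le> ip d a a"
  by (simp add: ip_def sum_nonneg)

lemma ip_self_eq_0_iff: "ip d a a = 0 \<longleftrightarrow> (\<forall>x<d. a x = 0)"
  by (auto simp: ip_def sum_nonneg_eq_0_iff)

lemma ip_self_eq_0: "ip d a a = 0 \<Longrightarrow> ip d a b = 0"
  using ip_self_eq_0_iff[of d a] by (simp add: ip_def)

lemma orthonormal_ip:
  "orthonormal d m e \<longleftrightarrow> (\<forall>j<m. \<forall>j'<m. ip d (e j) (e j') = (if j = j' then 1 else 0))"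
  by (simp add: orthonormal_def ip_def)

text \<open>
  Gaussian elimination: one equation serves to eliminate one unknown. Index sets instead of initial
  segments of the natural numbers spare the reordering that moves the pivot to the end.
\<close>

lemma homogeneous_system_nontrivial:
  fixes A :: "'i \<Rightarrow> 'j \<Rightarrow> real"
  assumes "finite I" "finite J" "card I < card J"
  shows "\<exists>n. (\<exists>j\<in>J. n j \<noteq> 0) \<and> (\<forall>i\<in>I. (\<Sum>j\<in>J. A i j * n j) = 0)"
  using assms
proof (induction I arbitrary: J A rule: finite_induct)
  case empty
  then have "J \<noteq> {}" by auto
  then show ?case by (intro exI[of _ "\<lambda>_. 1"]) auto
next
  case (insert k I)
  show ?case
  proof (cases "\<forall>j\<in>J. A k j = 0")
    case True
    have "card I < card J" using insert by simp
    from insert.IH[OF \<open>finite J\<close> this, of A] True show ?thesis by auto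
  next
    case False
    (* The unknown p is expressed by the others through equation k; A' is the system that remains. *)
    then obtain p where p: "p \<in> J" "A k p \<noteq> 0" by blast
    define A' where "A' i j = A i j - A i p * A k j / A k p" for i j
    have "card I < card (J - {p})" using insert p by auto
    from insert.IH[OF _ this, of A'] insert.prems obtain n
      where n: "\<exists>j\<in>J-{p}. n j \<noteq> 0" "\<And>i. i \<in> I \<Longrightarrow> (\<Sum>j\<in>J-{p}. A' i j * n j) = 0"
      by auto
    define t where "t = - (\<Sum>j\<in>J-{p}. A k j * n j) / A k p"
    have split: "(\<Sum>j\<in>J. A i j * (n(p := t)) j) = A i p * t + (\<Sum>j\<in>J-{p}. A i j * n j)" for i
    proof -
      have "(\<Sum>j\<in>J. A i j * (n(p := t)) j) = A i p * t + (\<Sum>j\<in>J-{p}. A i j * (n(p := t)) j)"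
        using p insert.prems by (subst sum.remove[of _ p]) auto
      also have "(\<Sum>j\<in>J-{p}. A i j * (n(p := t)) j) = (\<Sum>j\<in>J-{p}. A i j * n j)"
        by (intro sum.cong) auto
      finally show ?thesis .
    qed
    have "(\<Sum>j\<in>J. A i j * (n(p := t)) j) = 0" if "i \<in> I" for i
    proof -
      have "(\<Sum>j\<in>J-{p}. A' i j * n j)
          = (\<Sum>j\<in>J-{p}. A i j * n j) - (\<Sum>j\<in>J-{p}. A i p / A k p * (A k j * n j))"
        by (simp add: A'_def algebra_simps sum_subtractf)
      also have "(\<Sum>j\<in>J-{p}. A i p / A k p * (A k j * n j)) = - A i p * t"
        by (simp add: t_def sum_distrib_left sum_divide_distrib sum_negf)
      finally show ?thesis using n(2)[OF that] split by simp
    qed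
    moreover have "(\<Sum>j\<in>J. A k j * (n(p := t)) j) = 0"
      unfolding split using p by (simp add: t_def)
    moreover have "\<exists>j\<in>J. (n(p := t)) j \<noteq> 0" using n(1) by auto
    ultimately show ?thesis by (intro exI[of _ "n(p := t)"]) auto
  qed
qed

text \<open>
  A zero vector has no direction of its own. While one is left, fewer than \<open>d\<close> linear equations
  express orthogonality to all other members of the family, so that it can be replaced by a nonzero
  solution; afterwards every vector can be normalized. Since zero vectors are permitted, this lemma
  also extends an orthonormal family to a basis: pad it with zeros.
\<close>

lemma orthogonal_family_normalise:
  assumes "m \<le> d" "\<And>i j. i < m \<Longrightarrow> j < m \<Longrightarrow> i \<noteq> j \<Longrightarrow> ip d (g i) (g j) = 0"
  shows "\<exists>e. orthonormal d m e \<and> (\<forall>i<m. \<forall>x<d. g i x = sqrt (ip d (g i) (g i)) * e i x)"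
  using assms(2)
proof (induction "card {i. i < m \<and> ip d (g i) (g i) = 0}" arbitrary: g rule: less_induct)
  case less
  show ?case
  proof (cases "\<exists>i<m. ip d (g i) (g i) = 0")
    case False
    define e where "e i x = inverse (sqrt (ip d (g i) (g i))) * g i x" for i x
    have pos: "0 < ip d (g i) (g i)" if "i < m" for i
      using False that ip_self_nonneg[of d "g i"] by (metis less_eq_real_def)
    have e: "ip d (e i) (e j) = inverse (sqrt (ip d (g i) (g i))) * (inverse (sqrt (ip d (g j) (g j))) * ip d (g i) (g j))" for i j
      unfolding e_def ip_linear by simp
    have "ip d (e i) (e j) = (if i = j then 1 else 0)" if "i < m" "j < m" for i j
    proof (cases "i = j")
      case True
      then show ?thesis using pos[of i] that
        by (simp add: e field_simps)
    next
      case False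
      then show ?thesis using less.prems[OF that] by (simp add: e)
    qed
    moreover have "g i x = sqrt (ip d (g i) (g i)) * e i x" if "i < m" for i x
      using pos[OF that] by (simp add: e_def)
    ultimately show ?thesis unfolding orthonormal_ip by (intro exI[of _ e]) auto
  next
    case True
    then obtain i where i: "i < m" "ip d (g i) (g i) = 0" by blast
    have "card ({..<m} - {i}) < card {..<d}" using i assms(1) by simp
    from homogeneous_system_nontrivial[OF _ _ this, of g] obtain n
      where n: "\<exists>x<d. n x \<noteq> 0" "\<And>j. j < m \<Longrightarrow> j \<noteq> i \<Longrightarrow> ip d (g j) n = 0"
      by (auto simp: ip_def)
    define g' where "g' = g(i := n)"
    have npos: "ip d n n \<noteq> 0" using n(1) by (simp add: ip_self_eq_0_iff)
    have zeros: "{j. j < m \<and> ip d (g' j) (g' j) = 0} = {j. j < m \<and> ip d (g j) (g j) = 0} - {i}"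
      using npos by (auto simp: g'_def)
    have "card {j. j < m \<and> ip d (g' j) (g' j) = 0} < card {j. j < m \<and> ip d (g j) (g j) = 0}"
      unfolding zeros using i by (intro card_Diff1_less) auto
    moreover have "ip d (g' j) (g' j') = 0" if "j < m" "j' < m" "j \<noteq> j'" for j j'
      using that n(2) less.prems by (auto simp: g'_def ip_commute[of d n])
    ultimately obtain e where e: "orthonormal d m e"
        "\<And>j x. j < m \<Longrightarrow> x < d \<Longrightarrow> g' j x = sqrt (ip d (g' j) (g' j)) * e j x"
      using less.hyps[of g'] by blast
    have "g j x = sqrt (ip d (g j) (g j)) * e j x" if "j < m" "x < d" for j x
      using e(2)[OF that] i that by (cases "j = i") (auto simp: g'_def ip_self_eq_0_iff)
    with e(1) show ?thesis by blast
  qed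
qed

text \<open>
  If the expansion failed, its remainder would be a further nonzero vector orthogonal to the \<open>d\<close>
  given ones; but \<open>d + 1\<close> vectors in \<open>\<real>\<^sup>d\<close> are linearly dependent, and nonzero orthogonal vectors
  are not.
\<close>

lemma orthonormal_basis_expansion:
  assumes e: "orthonormal d d e" and x: "x < d"
  shows "y x = (\<Sum>j<d. ip d y (e j) * e j x)"
proof (rule ccontr)
  define z where "z x = y x - (\<Sum>j<d. ip d y (e j) * e j x)" for x
  assume "y x \<noteq> (\<Sum>j<d. ip d y (e j) * e j x)"
  then have zz: "ip d z z \<noteq> 0" using x by (auto simp: ip_self_eq_0_iff z_def)
  have ze: "ip d z (e j) = 0" if "j < d" for j
  proof -
    have "(\<Sum>i<d. ip d y (e i) * ip d (e i) (e j)) = (\<Sum>i<d. if i = j then ip d y (e j) else 0)"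
      using e that by (intro sum.cong) (auto simp: orthonormal_ip)
    then show ?thesis using that unfolding z_def ip_linear by simp
  qed
  define g where "g = e(d := z)"
  have g: "ip d (g i) (g j) = 0" if "i \<le> d" "j \<le> d" "i \<noteq> j" for i j
    using that e ze by (auto simp: g_def orthonormal_ip ip_commute[of d _ z])
  have gg: "ip d (g i) (g i) \<noteq> 0" if "i \<le> d" for i
    using that e zz by (cases "i = d") (auto simp: g_def orthonormal_ip)
  have "card {..<d} < card {..d}" by simp
  from homogeneous_system_nontrivial[OF _ _ this, of "\<lambda>x j. g j x"] obtain n i
    where n: "i \<le> d" "n i \<noteq> 0" "\<And>x. x < d \<Longrightarrow> (\<Sum>j\<le>d. n j * g j x) = 0"
    by (auto simp: mult.commute)
  have "0 = ip d (\<lambda>x. \<Sum>j\<le>d. n j * g j x) (g i)"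
    using n(3) by (simp add: ip_def)
  also have "\<dots> = (\<Sum>j\<le>d. if j = i then n i * ip d (g i) (g i) else 0)"
    unfolding ip_linear using g n(1) by (intro sum.cong) auto
  also have "\<dots> = n i * ip d (g i) (g i)" using n(1) by simp
  finally show False using n gg by auto
qed

lemma orthonormal_basis_ip:
  assumes e: "orthonormal d d e"
  shows "ip d y z = (\<Sum>j<d. ip d y (e j) * ip d z (e j))"
proof -
  have "ip d y z = ip d (\<lambda>x. \<Sum>j<d. ip d y (e j) * e j x) z"
    using orthonormal_basis_expansion[OF e] by (intro ip_cong) auto
  then show ?thesis unfolding ip_linear by (simp add: ip_commute)
qed

section \<open>Gram-Schmidt orthogonalization and heights\<close>

text \<open>
  The Gram-Schmidt process without normalization. A vector that depends on its predecessors yields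
  zero, and the convention \<open>x / 0 = 0\<close> then drops it from all later projections, so dependent
  families need no separate treatment. Only the coordinates below \<open>d\<close> matter.
\<close>

function gs :: "nat \<Rightarrow> (nat \<Rightarrow> nat \<Rightarrow> real) \<Rightarrow> nat \<Rightarrow> nat \<Rightarrow> real" where
  "gs d v i = (\<lambda>x. v i x - (\<Sum>j<i. ip d (v i) (gs d v j) / ip d (gs d v j) (gs d v j) * gs d v j x))"
  by pat_completeness auto
termination by (relation "Wellfounded.measure (\<lambda>(d, v, i). i)") auto

declare gs.simps [simp del]

text \<open>
  The distance of \<open>v i\<close> from the linear span of its predecessors.
\<close>

definition height :: "nat \<Rightarrow> (nat \<Rightarrow> nat \<Rightarrow> real) \<Rightarrow> nat \<Rightarrow> real" where
  "height d v i = sqrt (ip d (gs d v i) (gs d v i))"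

lemma height_nonneg [simp]: "0 \<le> height d v i"
  by (simp add: height_def)

lemma height_sq: "height d v i * height d v i = ip d (gs d v i) (gs d v i)"
  by (simp add: height_def)

definition gs_coeff :: "nat \<Rightarrow> (nat \<Rightarrow> nat \<Rightarrow> real) \<Rightarrow> nat \<Rightarrow> nat \<Rightarrow> real" where
  "gs_coeff d v i j = (if j < i then ip d (v i) (gs d v j) / ip d (gs d v j) (gs d v j) else if j = i then 1 else 0)"

lemma gs_expansion: "v i x = (\<Sum>j\<le>i. gs_coeff d v i j * gs d v j x)"
proof -
  have "gs d v i x = v i x - (\<Sum>j<i. gs_coeff d v i j * gs d v j x)"
    by (subst gs.simps) (simp add: gs_coeff_def)
  then show ?thesis by (simp add: lessThan_Suc_atMost[symmetric] gs_coeff_def)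
qed

lemma gs_orthogonal: "i \<noteq> j \<Longrightarrow> ip d (gs d v i) (gs d v j) = 0"
proof -
  have "ip d (gs d v i) (gs d v j) = 0" if "j < i" for i j
    using that
  proof (induction i arbitrary: j rule: less_induct)
    case (less i)
    have 1: "ip d (gs d v k) (gs d v j) = 0" if "k < i" "k \<noteq> j" for k
      using less.IH[of k j] less.IH[of j k] less.prems that
      by (metis ip_commute linorder_neqE_nat)
    have "ip d (gs d v i) (gs d v j) = ip d (v i) (gs d v j)
        - (\<Sum>k<i. ip d (v i) (gs d v k) / ip d (gs d v k) (gs d v k) * ip d (gs d v k) (gs d v j))"
      by (subst gs.simps) (simp only: ip_linear)
    also have "(\<Sum>k<i. ip d (v i) (gs d v k) / ip d (gs d v k) (gs d v k) * ip d (gs d v k) (gs d v j))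
      = (\<Sum>k<i. if k = j then ip d (v i) (gs d v j) else 0)"
      using 1 ip_self_eq_0[of d "gs d v j" "v i"]
      by (intro sum.cong) (auto simp: ip_commute)
    finally show ?case using less.prems by simp
  qed
  then show "i \<noteq> j \<Longrightarrow> ip d (gs d v i) (gs d v j) = 0"
    by (metis ip_commute linorder_neqE_nat)
qed

lemma ip_gs_orthogonal: "j < i \<Longrightarrow> ip d (gs d v i) (v j) = 0"
proof -
  assume "j < i"
  have "ip d (gs d v i) (v j) = ip d (gs d v i) (\<lambda>x. \<Sum>k\<le>j. gs_coeff d v j k * gs d v k x)"
    using gs_expansion[of v j _ d] by (intro ip_cong) auto
  also have "\<dots> = 0"
    unfolding ip_linear using gs_orthogonal \<open>j < i\<close> by (intro sum.neutral) auto
  finally show ?thesis .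
qed

lemma ip_gs_self: "ip d (gs d v i) (v i) = ip d (gs d v i) (gs d v i)"
proof -
  have "ip d (gs d v i) (v i) = ip d (gs d v i) (\<lambda>x. \<Sum>k\<le>i. gs_coeff d v i k * gs d v k x)"
    using gs_expansion[of v i _ d] by (intro ip_cong) auto
  also have "\<dots> = (\<Sum>k\<le>i. if k = i then ip d (gs d v i) (gs d v i) else 0)"
    unfolding ip_linear using gs_orthogonal[of i _ d v]
    by (intro sum.cong) (auto simp: gs_coeff_def)
  finally show ?thesis by simp
qed

text \<open>
  The coefficients are those of the inverse of the unitriangular matrix \<open>gs_coeff\<close>, obtained by
  substituting the combinations for \<open>gs d v j\<close> with \<open>j < i\<close> into the recursion.
\<close>

lemma gs_combination: "\<exists>b. \<forall>x. gs d v i x = v i x - (\<Sum>j<i. b j * v j x)"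
proof (induction i rule: less_induct)
  case (less i)
  then obtain B where B: "\<And>j x. j < i \<Longrightarrow> gs d v j x = v j x - (\<Sum>k<j. B j k * v k x)"
    by metis
  define b where "b k = gs_coeff d v i k - (\<Sum>j\<in>{k<..<i}. gs_coeff d v i j * B j k)" for k
  have "gs d v i x = v i x - (\<Sum>k<i. b k * v k x)" for x
  proof -
    have "gs d v i x = v i x - (\<Sum>j<i. gs_coeff d v i j * gs d v j x)"
      by (subst gs.simps) (simp add: gs_coeff_def)
    also have "(\<Sum>j<i. gs_coeff d v i j * gs d v j x)
        = (\<Sum>j<i. gs_coeff d v i j * v j x) - (\<Sum>j<i. \<Sum>k<j. gs_coeff d v i j * B j k * v k x)"
      by (simp add: B algebra_simps sum_subtractf sum_distrib_left)
    also have "(\<Sum>j<i. \<Sum>k<j. gs_coeff d v i j * B j k * v k x)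
        = (\<Sum>k<i. \<Sum>j\<in>{k<..<i}. gs_coeff d v i j * B j k * v k x)"
      by (simp add: sum.Sigma, rule sum.reindex_bij_witness[of _ "\<lambda>(a,b). (b,a)" "\<lambda>(a,b). (b,a)"]) auto
    also have "(\<Sum>j<i. gs_coeff d v i j * v j x) - \<dots> = (\<Sum>k<i. b k * v k x)"
      by (simp add: b_def left_diff_distrib sum_subtractf sum_distrib_right)
    finally show ?thesis .
  qed
  then show ?case by blast
qed

text \<open>
  Since \<open>gs d v i\<close> is orthogonal to all predecessors of \<open>v i\<close>, subtracting any combination of them
  does not change the inner product. By Cauchy-Schwarz the height is therefore minimal among the
  lengths of all such differences.
\<close>

lemma height_sq_combination:
  assumes "\<And>x. x < d \<Longrightarrow> z x = v i x - (\<Sum>j\<in>J. b j * v j x)" "J \<subseteq> {..<i}"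
  shows "height d v i * height d v i = ip d (gs d v i) z"
proof -
  have "ip d (gs d v i) z = ip d (gs d v i) (\<lambda>x. v i x - (\<Sum>j\<in>J. b j * v j x))"
    using assms by (intro ip_cong) auto
  also have "\<dots> = ip d (gs d v i) (v i) - (\<Sum>j\<in>J. b j * ip d (gs d v i) (v j))"
    unfolding ip_linear by simp
  also have "(\<Sum>j\<in>J. b j * ip d (gs d v i) (v j)) = 0"
    using assms by (intro sum.neutral) (auto simp: ip_gs_orthogonal subset_iff)
  finally show ?thesis by (simp add: ip_gs_self height_sq)
qed

lemma gs_cong:
  assumes "\<And>j x. j \<le> i \<Longrightarrow> v j x = v' j x"
  shows "gs d v i = gs d v' i"
  using assms
proof (induction i rule: less_induct)
  case (less i)
  have "gs d v j = gs d v' j" if "j < i" for j using less that by auto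
  moreover have "v i = v' i" using less by auto
  ultimately show ?case by (subst (1 2) gs.simps) auto
qed

lemma height_cong:
  assumes "\<And>j x. j \<le> i \<Longrightarrow> v j x = v' j x"
  shows "height d v i = height d v' i"
  unfolding height_def using gs_cong[of i v v' d] assms by simp

lemma ip_isometry:
  assumes e: "orthonormal d m e"
    and a: "\<And>x. x < d \<Longrightarrow> a' x = (\<Sum>j<m. a j * e j x)"
    and b: "\<And>x. x < d \<Longrightarrow> b' x = (\<Sum>j<m. b j * e j x)"
  shows "ip d a' b' = ip m a b"
proof -
  have "ip d a' b' = ip d (\<lambda>x. \<Sum>j<m. a j * e j x) (\<lambda>x. \<Sum>j<m. b j * e j x)"
    using a b by (intro ip_cong) auto
  also have "\<dots> = (\<Sum>i<m. a i * (\<Sum>j<m. b j * ip d (e i) (e j)))"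
    by (simp only: ip_sum_left ip_sum_right)
  also have "\<dots> = (\<Sum>i<m. a i * (\<Sum>j<m. if j = i then b i else 0))"
    using e by (intro sum.cong refl arg_cong2[where f="(*)"]) (auto simp: orthonormal_ip)
  finally show ?thesis by (simp add: ip_def)
qed

text \<open>
  The process uses inner products only, so it commutes with the isometry from \<open>\<real>\<^sup>m\<close> to \<open>\<real>\<^sup>d\<close>
  given by an orthonormal family. Hence heights can be computed in the coordinates of any flat.
\<close>

lemma gs_isometry:
  assumes e: "orthonormal d m e"
    and v: "\<And>i x. i \<le> k \<Longrightarrow> x < d \<Longrightarrow> v i x = (\<Sum>j<m. w i j * e j x)"
  shows "x < d \<Longrightarrow> gs d v k x = (\<Sum>j<m. gs m w k j * e j x)"
  using v
proof (induction k arbitrary: x rule: less_induct)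
  case (less k)
  have IH: "gs d v i x = (\<Sum>j<m. gs m w i j * e j x)" if "i < k" "x < d" for i x
    using less that by auto
  have ip1: "ip d (v k) (gs d v i) = ip m (w k) (gs m w i)" if "i < k" for i
    using IH that less.prems by (intro ip_isometry[OF e]) auto
  have ip2: "ip d (gs d v i) (gs d v i) = ip m (gs m w i) (gs m w i)" if "i < k" for i
    using IH that by (intro ip_isometry[OF e]) auto
  have "gs d v k x = v k x - (\<Sum>i<k. ip m (w k) (gs m w i) / ip m (gs m w i) (gs m w i) * gs d v i x)"
    by (subst gs.simps) (simp add: ip1 ip2)
  also have "\<dots> = (\<Sum>j<m. w k j * e j x) - (\<Sum>i<k. \<Sum>j<m. ip m (w k) (gs m w i) / ip m (gs m w i) (gs m w i) * (gs m w i j * e j x))"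
    using less.prems by (simp add: IH sum_distrib_left)
  also have "\<dots> = (\<Sum>j<m. (w k j - (\<Sum>i<k. ip m (w k) (gs m w i) / ip m (gs m w i) (gs m w i) * gs m w i j)) * e j x)"
    by (subst sum.swap) (simp add: left_diff_distrib sum_subtractf sum_distrib_right mult.assoc)
  also have "\<dots> = (\<Sum>j<m. gs m w k j * e j x)"
    by (subst (3) gs.simps) simp
  finally show ?case .
qed

lemma height_isometry:
  assumes e: "orthonormal d m e"
    and v: "\<And>i x. i \<le> k \<Longrightarrow> x < d \<Longrightarrow> v i x = (\<Sum>j<m. w i j * e j x)"
  shows "height d v k = height m w k"
  unfolding height_def
  by (intro arg_cong[of _ _ sqrt] ip_isometry[OF e] gs_isometry[OF e v]) auto

text \<open>
  In this basis the matrix of \<open>v\<close> is triangular with the heights on the diagonal, even for dependent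
  vectors.
\<close>

lemma gs_adapted_frame:
  assumes "m \<le> d"
  shows "\<exists>e. orthonormal d d e \<and> (\<forall>i<m. \<forall>x<d. gs d v i x = height d v i * e i x)"
proof -
  define g where "g i = (if i < m then gs d v i else (\<lambda>_. 0))" for i
  have "ip d (g i) (g j) = 0" if "i < d" "j < d" "i \<noteq> j" for i j
    using gs_orthogonal[OF that(3)] by (auto simp: g_def ip_def)
  then obtain e where e: "orthonormal d d e"
      "\<And>i x. i < d \<Longrightarrow> x < d \<Longrightarrow> g i x = sqrt (ip d (g i) (g i)) * e i x"
    using orthogonal_family_normalise[of d d g] by blast
  have "gs d v i x = height d v i * e i x" if "i < m" "x < d" for i x
    using e(2)[of i x] assms that by (simp add: g_def height_def)
  with e(1) show ?thesis by blast
qed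

section \<open>Triangular and orthogonal changes of variables\<close>

abbreviation Leb :: "nat \<Rightarrow> (nat \<Rightarrow> real) measure" where
  "Leb m \<equiv> Pi\<^sub>M {..<m} (\<lambda>_. lborel)"

interpretation lborel_product: product_sigma_finite "\<lambda>_::nat. lborel :: real measure"
  by standard

lemma sigma_finite_Leb: "sigma_finite_measure (Leb m)"
  by (rule lborel_product.sigma_finite) auto

lemma pair_sigma_finite_Leb: "pair_sigma_finite (Leb m) (Leb m)"
  by (intro pair_sigma_finite.intro sigma_finite_Leb)

text \<open>
  Fubini, one coordinate at a time. The last coordinate \<open>y\<close> is only scaled and translated, and for
  fixed \<open>y\<close> it contributes a translation \<open>y * R m j\<close> to the others. The translation vector \<open>a\<close> is
  part of the statement because it absorbs this contribution in the induction.
\<close>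

lemma nn_integral_triangular:
  assumes "f \<in> borel_measurable (Leb m)" "\<And>j. j < m \<Longrightarrow> R j j \<noteq> 0"
  shows "(\<integral>\<^sup>+s. f (\<lambda>j\<in>{..<m}. a j + (\<Sum>i\<in>{j..<m}. s i * R i j)) \<partial>Leb m) * ennreal (\<Prod>j<m. \<bar>R j j\<bar>)
       = (\<integral>\<^sup>+s. f s \<partial>Leb m)"
  using assms
proof (induction m arbitrary: f a)
  case 0
  show ?case by (simp add: PiM_empty nn_integral_count_space_finite)
next
  case (Suc m)
  note [measurable] = Suc.prems(1)
  (* The map on the first m coordinates when the last one is y. *)
  let ?T = "\<lambda>y x. \<lambda>j\<in>{..<m}. (a j + y * R m j) + (\<Sum>i\<in>{j..<m}. x i * R i j)"
  have T: "(\<lambda>j\<in>{..<Suc m}. a j + (\<Sum>i\<in>{j..<Suc m}. (x(m := y)) i * R i j))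
      = (?T y x)(m := a m + R m m * y)" for x y
    by (auto simp: fun_eq_iff restrict_def sum.atLeastLessThan_Suc less_Suc_eq algebra_simps intro!: sum.cong)
  have f: "f \<in> borel_measurable (Pi\<^sub>M (insert m {..<m}) (\<lambda>_. lborel))"
    using Suc.prems(1) by (simp add: lessThan_Suc)
  have meas: "(\<lambda>s. f (\<lambda>j\<in>{..<Suc m}. a j + (\<Sum>i\<in>{j..<Suc m}. s i * R i j)))
      \<in> borel_measurable (Pi\<^sub>M (insert m {..<m}) (\<lambda>_. lborel))"
    unfolding lessThan_Suc[symmetric]
    by (measurable; auto)
  have sec: "(\<lambda>x. f (x(m := z))) \<in> borel_measurable (Leb m)" for z
    using f by (intro measurable_compose[OF _ f]) (auto intro!: measurable_fun_upd)
  have swap: "(\<lambda>z. \<integral>\<^sup>+x. g (x(m := z)) \<partial>Leb m) \<in> borel_measurable lborel"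
    if g: "g \<in> borel_measurable (Pi\<^sub>M (insert m {..<m}) (\<lambda>_. lborel))" for g :: "_ \<Rightarrow> ennreal"
  proof -
    interpret sigma_finite_measure "Leb m" by (rule sigma_finite_Leb)
    have "(\<lambda>w. g ((\<lambda>(x, z). x(m := z)) w)) \<in> borel_measurable (Leb m \<Otimes>\<^sub>M lborel)"
      by (rule measurable_compose[OF measurable_add_dim g])
    then have "(\<lambda>(z, x). g (x(m := z))) \<in> borel_measurable (lborel \<Otimes>\<^sub>M Leb m)"
      by (subst measurable_pair_swap_iff) (simp add: case_prod_unfold)
    then show ?thesis by (rule borel_measurable_nn_integral)
  qed
  define g where "g s = f (\<lambda>j\<in>{..<Suc m}. a j + (\<Sum>i\<in>{j..<Suc m}. s i * R i j))" for s
  define h where "h y = (\<integral>\<^sup>+x. f ((?T y x)(m := a m + R m m * y)) \<partial>Leb m)" for y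
  have gT: "g (x(m := y)) = f ((?T y x)(m := a m + R m m * y))" for x y
    by (simp only: g_def T)
  have gm: "g \<in> borel_measurable (Pi\<^sub>M (insert m {..<m}) (\<lambda>_. lborel))"
    unfolding g_def[abs_def] by (rule meas)
  have hm: "h \<in> borel_measurable lborel"
    using swap[OF gm] by (simp only: gT h_def[abs_def])
  have "(\<integral>\<^sup>+s. g s \<partial>Leb (Suc m)) = (\<integral>\<^sup>+y. \<integral>\<^sup>+x. g (x(m := y)) \<partial>Leb m \<partial>lborel)"
    using gm unfolding lessThan_Suc
    by (intro lborel_product.product_nn_integral_insert_rev) auto
  also have "\<dots> = (\<integral>\<^sup>+y. h y \<partial>lborel)"
    by (simp only: gT h_def)
  also have "\<dots> * ennreal (\<Prod>j<m. \<bar>R j j\<bar>) = (\<integral>\<^sup>+y. h y * ennreal (\<Prod>j<m. \<bar>R j j\<bar>) \<partial>lborel)"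
    by (rule nn_integral_multc[OF hm, symmetric])
  also have "\<dots> = (\<integral>\<^sup>+y. \<integral>\<^sup>+x. f (x(m := a m + R m m * y)) \<partial>Leb m \<partial>lborel)"
    unfolding h_def using Suc.prems(2) by (intro nn_integral_cong Suc.IH[OF sec]) auto
  also have "\<dots> * ennreal \<bar>R m m\<bar> = (\<integral>\<^sup>+y. \<integral>\<^sup>+x. f (x(m := y)) \<partial>Leb m \<partial>lborel)"
    using swap[OF f] Suc.prems(2)
    by (subst (2) nn_integral_real_affine[where c = "R m m" and t = "a m"]) (auto simp: mult.commute)
  also have "\<dots> = (\<integral>\<^sup>+s. f s \<partial>Leb (Suc m))"
    unfolding lessThan_Suc
    by (subst lborel_product.product_nn_integral_insert_rev[OF _ _ f]) auto
  finally have eq: "(\<integral>\<^sup>+s. g s \<partial>Leb (Suc m)) * ennreal (\<Prod>j<m. \<bar>R j j\<bar>) * ennreal \<bar>R m m\<bar> = (\<integral>\<^sup>+s. f s \<partial>Leb (Suc m))" .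
  have "ennreal (\<Prod>j<Suc m. \<bar>R j j\<bar>) = ennreal (\<Prod>j<m. \<bar>R j j\<bar>) * ennreal \<bar>R m m\<bar>"
    by (simp add: ennreal_mult prod_nonneg)
  then show ?case
    using eq by (simp only: g_def mult.assoc)
qed

lemma restrict_id_Leb: "s \<in> space (Leb m) \<Longrightarrow> (\<lambda>j\<in>{..<m}. s j) = s"
  by (auto simp: space_PiM PiE_def extensional_restrict)

lemma nn_integral_shift:
  assumes "f \<in> borel_measurable (Leb m)"
  shows "(\<integral>\<^sup>+s. f (\<lambda>j\<in>{..<m}. a j + s j) \<partial>Leb m) = (\<integral>\<^sup>+s. f s \<partial>Leb m)"
proof -
  have "(\<Sum>i\<in>{j..<m}. s i * (if i = j then 1 else 0)) = s j" if "j < m" for s :: "nat \<Rightarrow> real" and j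
    using that by (simp add: if_distrib cong: if_cong)
  then have "(\<lambda>j\<in>{..<m}. a j + (\<Sum>i\<in>{j..<m}. s i * (if i = j then 1 else 0))) = (\<lambda>j\<in>{..<m}. a j + s j)" for s
    by (auto simp: restrict_def fun_eq_iff)
  with nn_integral_triangular[OF assms, of "\<lambda>i j. if i = j then 1 else 0" a] show ?thesis
    by simp
qed

lemma nn_integral_reflect:
  assumes "f \<in> borel_measurable (Leb m)"
  shows "(\<integral>\<^sup>+s. f (\<lambda>j\<in>{..<m}. a j - s j) \<partial>Leb m) = (\<integral>\<^sup>+s. f s \<partial>Leb m)"
proof -
  have "(\<Sum>i\<in>{j..<m}. s i * (if i = j then -1 else 0)) = - s j" if "j < m" for s :: "nat \<Rightarrow> real" and j
    using that by (simp add: if_distrib cong: if_cong)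
  then have "(\<lambda>j\<in>{..<m}. a j + (\<Sum>i\<in>{j..<m}. s i * (if i = j then -1 else 0))) = (\<lambda>j\<in>{..<m}. a j - s j)" for s
    by (auto simp: restrict_def fun_eq_iff)
  with nn_integral_triangular[OF assms, of "\<lambda>i j. if i = j then -1 else 0" a] show ?thesis
    by simp
qed

lemma emeasure_Leb_box:
  "0 \<le> r \<Longrightarrow> emeasure (Leb m) ({..<m} \<rightarrow>\<^sub>E {a..a + r}) = ennreal (r ^ m)"
  by (subst lborel_product.emeasure_PiM) (auto simp: ennreal_power)

lemma sets_Leb_box: "{..<m} \<rightarrow>\<^sub>E {a..b} \<in> sets (Leb m)"
  by (intro sets_PiM_I_finite) auto

text \<open>
  Let \<open>P\<close> be the orthogonal map \<open>t \<mapsto> (\<langle>t, e j\<rangle>)\<^sub>j\<close>, let \<open>Q\<close> be its inverse, and let \<open>B\<close> be the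
  unit ball. The double integral of \<open>1\<^sub>X (P x) * 1\<^sub>B y\<close> is the volume of the preimage of \<open>X\<close> times the
  volume of \<open>B\<close>. The translation \<open>x \<mapsto> x + Q y\<close>, followed by \<open>y \<mapsto> y - P x\<close>, turns the integrand
  into \<open>1\<^sub>X y * 1\<^sub>B (y - P x)\<close>, and \<open>y - P x \<in> B\<close> if and only if \<open>Q y - x \<in> B\<close> as \<open>P\<close> preserves
  lengths. By translation and reflection invariance this integrates to the volume of \<open>X\<close> times
  that of \<open>B\<close>. The volume of \<open>B\<close> is positive and finite and cancels.
\<close>

lemma emeasure_orthogonal_vimage:
  assumes e: "orthonormal m m e" and X: "X \<in> sets (Leb m)"
  shows "emeasure (Leb m) {t \<in> space (Leb m). (\<lambda>j\<in>{..<m}. ip m t (e j)) \<in> X} = emeasure (Leb m) X"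
proof -
  define B where "B = {s \<in> space (Leb m). ip m s s < 1}"
  define f where "f = (indicator X :: (nat \<Rightarrow> real) \<Rightarrow> ennreal)"
  define b where "b = (indicator B :: (nat \<Rightarrow> real) \<Rightarrow> ennreal)"
  let ?P = "\<lambda>t. \<lambda>j\<in>{..<m}. ip m t (e j)"
  let ?Q = "\<lambda>y. \<lambda>k\<in>{..<m}. \<Sum>j<m. y j * e j k"
  note [measurable] = X
  have [measurable]: "B \<in> sets (Leb m)" unfolding B_def ip_def by measurable
  have [measurable]: "f \<in> borel_measurable (Leb m)" "b \<in> borel_measurable (Leb m)"
    unfolding f_def b_def by measurable
  have P[measurable]: "?P \<in> measurable (Leb m) (Leb m)"
    unfolding ip_def by measurable
  have Q[measurable]: "?Q \<in> measurable (Leb m) (Leb m)"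
    by measurable
  interpret pair_sigma_finite "Leb m" "Leb m" by (rule pair_sigma_finite_Leb)
  have PQ: "ip m (?Q y) (e j) = y j" if "j < m" for y j
  proof -
    have "ip m (?Q y) (e j) = ip m (\<lambda>k. \<Sum>j<m. y j * e j k) (e j)" by (intro ip_cong) auto
    also have "\<dots> = (\<Sum>i<m. if i = j then y j else 0)"
      unfolding ip_linear using e that by (intro sum.cong) (auto simp: orthonormal_ip)
    finally show ?thesis using that by simp
  qed
  have Pshift: "?P (\<lambda>j\<in>{..<m}. ?Q y j + x j) = (\<lambda>j\<in>{..<m}. ?P x j + y j)" for x y
  proof -
    have "ip m (\<lambda>k\<in>{..<m}. ?Q y k + x k) (e j) = ip m x (e j) + y j" if "j < m" for j
    proof -
      have "ip m (\<lambda>k\<in>{..<m}. ?Q y k + x k) (e j) = ip m (\<lambda>k. ?Q y k + x k) (e j)"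
        by (intro ip_cong) auto
      also have "\<dots> = ip m (?Q y) (e j) + ip m x (e j)" by (rule ip_add_left)
      finally show ?thesis using PQ[OF that] by simp
    qed
    then show ?thesis by (intro restrict_ext) auto
  qed
  have Bsym: "b (\<lambda>j\<in>{..<m}. - ?P x j + y j) = b (\<lambda>j\<in>{..<m}. ?Q y j - x j)" for x y
  proof -
    let ?z = "\<lambda>j\<in>{..<m}. ?Q y j - x j"
    have z: "ip m ?z (e j) = y j - ip m x (e j)" if "j < m" for j
    proof -
      have "ip m ?z (e j) = ip m (\<lambda>k. ?Q y k - x k) (e j)" by (intro ip_cong) auto
      also have "\<dots> = ip m (?Q y) (e j) - ip m x (e j)" by (rule ip_diff_left)
      finally show ?thesis using PQ[OF that] by simp
    qed
    have "ip m (\<lambda>j\<in>{..<m}. - ?P x j + y j) (\<lambda>j\<in>{..<m}. - ?P x j + y j)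
        = ip m (\<lambda>j. ip m ?z (e j)) (\<lambda>j. ip m ?z (e j))"
      by (intro ip_cong) (subst z, simp, simp)+
    also have "\<dots> = (\<Sum>j<m. ip m ?z (e j) * ip m ?z (e j))"
      by (rule ip_def)
    also have "\<dots> = ip m ?z ?z" by (rule orthonormal_basis_ip[OF e, symmetric])
    finally show ?thesis by (simp add: b_def B_def indicator_def space_PiM)
  qed
  have comp: "(\<lambda>p. fst p j) \<in> borel_measurable (Leb m \<Otimes>\<^sub>M Leb m)"
      "(\<lambda>p. snd p j) \<in> borel_measurable (Leb m \<Otimes>\<^sub>M Leb m)" if "j < m" for j
    using that measurable_compose[OF measurable_fst[of "Leb m" "Leb m"] measurable_component_singleton[of j "{..<m}" "\<lambda>_. lborel"]]
      measurable_compose[OF measurable_snd[of "Leb m" "Leb m"] measurable_component_singleton[of j "{..<m}" "\<lambda>_. lborel"]]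
    by auto
  have m1: "(\<lambda>p. \<lambda>j\<in>{..<m}. ?P (snd p) j + fst p j) \<in> measurable (Leb m \<Otimes>\<^sub>M Leb m) (Leb m)"
    unfolding ip_def by (intro measurable_restrict) (auto intro!: borel_measurable_add borel_measurable_sum borel_measurable_times comp)
  have m2: "(\<lambda>p. \<lambda>j\<in>{..<m}. ?Q (snd p) j - fst p j) \<in> measurable (Leb m \<Otimes>\<^sub>M Leb m) (Leb m)"
    by (intro measurable_restrict) (auto intro!: borel_measurable_diff borel_measurable_sum borel_measurable_times comp)
  have F1: "case_prod (\<lambda>y x. f (\<lambda>j\<in>{..<m}. ?P x j + y j) * b y) \<in> borel_measurable (Leb m \<Otimes>\<^sub>M Leb m)"
    using borel_measurable_times_ennreal[OF measurable_compose[OF m1 \<open>f \<in> _\<close>] measurable_compose[OF measurable_fst \<open>b \<in> _\<close>]]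
    by (simp add: case_prod_unfold)
  have F2: "case_prod (\<lambda>x y. f y * b (\<lambda>j\<in>{..<m}. ?Q y j - x j)) \<in> borel_measurable (Leb m \<Otimes>\<^sub>M Leb m)"
    using borel_measurable_times_ennreal[OF measurable_compose[OF measurable_snd \<open>f \<in> _\<close>] measurable_compose[OF m2 \<open>b \<in> _\<close>]]
    by (simp add: case_prod_unfold)
  have "emeasure (Leb m) {t \<in> space (Leb m). ?P t \<in> X} * emeasure (Leb m) B
      = (\<integral>\<^sup>+x. f (?P x) \<partial>Leb m) * (\<integral>\<^sup>+y. b y \<partial>Leb m)"
  proof -
    have "(\<integral>\<^sup>+x. f (?P x) \<partial>Leb m) = (\<integral>\<^sup>+x. indicator {t \<in> space (Leb m). ?P t \<in> X} x \<partial>Leb m)"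
      by (intro nn_integral_cong) (auto simp: f_def indicator_def)
    then show ?thesis by (simp add: b_def)
  qed
  also have "\<dots> = (\<integral>\<^sup>+y. \<integral>\<^sup>+x. f (?P x) * b y \<partial>Leb m \<partial>Leb m)"
    by (simp add: nn_integral_cmult nn_integral_multc)
  also have "\<dots> = (\<integral>\<^sup>+y. \<integral>\<^sup>+x. f (?P (\<lambda>j\<in>{..<m}. ?Q y j + x j)) * b y \<partial>Leb m \<partial>Leb m)"
    by (intro nn_integral_cong nn_integral_shift[of "\<lambda>x. f (?P x) * b _" m "?Q _", symmetric]) measurable
  also have "\<dots> = (\<integral>\<^sup>+y. \<integral>\<^sup>+x. f (\<lambda>j\<in>{..<m}. ?P x j + y j) * b y \<partial>Leb m \<partial>Leb m)"
    by (simp only: Pshift)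
  also have "\<dots> = (\<integral>\<^sup>+x. \<integral>\<^sup>+y. f (\<lambda>j\<in>{..<m}. ?P x j + y j) * b y \<partial>Leb m \<partial>Leb m)"
    by (rule Fubini'[OF F1, symmetric])
  also have "\<dots> = (\<integral>\<^sup>+x. \<integral>\<^sup>+y. f y * b (\<lambda>j\<in>{..<m}. - ?P x j + y j) \<partial>Leb m \<partial>Leb m)"
  proof (rule nn_integral_cong)
    fix x
    have "(\<integral>\<^sup>+y. f (\<lambda>j\<in>{..<m}. ?P x j + y j) * b y \<partial>Leb m)
      = (\<integral>\<^sup>+y. f (\<lambda>j\<in>{..<m}. ?P x j + (\<lambda>j\<in>{..<m}. - ?P x j + y j) j) * b (\<lambda>j\<in>{..<m}. - ?P x j + y j) \<partial>Leb m)"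
      by (rule nn_integral_shift[of "\<lambda>y. f (\<lambda>j\<in>{..<m}. ?P x j + y j) * b y" m "\<lambda>j. - ?P x j", symmetric]) measurable
    also have "\<dots> = (\<integral>\<^sup>+y. f y * b (\<lambda>j\<in>{..<m}. - ?P x j + y j) \<partial>Leb m)"
    proof (intro nn_integral_cong)
      fix y assume y: "y \<in> space (Leb m)"
      have "(\<lambda>j\<in>{..<m}. ?P x j + (\<lambda>j\<in>{..<m}. - ?P x j + y j) j) = (\<lambda>j\<in>{..<m}. y j)" by auto
      then show "f (\<lambda>j\<in>{..<m}. ?P x j + (\<lambda>j\<in>{..<m}. - ?P x j + y j) j) * b (\<lambda>j\<in>{..<m}. - ?P x j + y j)
          = f y * b (\<lambda>j\<in>{..<m}. - ?P x j + y j)"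
        using restrict_id_Leb[OF y] by simp
    qed
    finally show "(\<integral>\<^sup>+y. f (\<lambda>j\<in>{..<m}. ?P x j + y j) * b y \<partial>Leb m)
      = (\<integral>\<^sup>+y. f y * b (\<lambda>j\<in>{..<m}. - ?P x j + y j) \<partial>Leb m)" .
  qed
  also have "\<dots> = (\<integral>\<^sup>+x. \<integral>\<^sup>+y. f y * b (\<lambda>j\<in>{..<m}. ?Q y j - x j) \<partial>Leb m \<partial>Leb m)"
    by (simp only: Bsym)
  also have "\<dots> = (\<integral>\<^sup>+y. \<integral>\<^sup>+x. f y * b (\<lambda>j\<in>{..<m}. ?Q y j - x j) \<partial>Leb m \<partial>Leb m)"
    by (rule Fubini'[OF F2, symmetric])
  also have "\<dots> = (\<integral>\<^sup>+y. f y * (\<integral>\<^sup>+x. b x \<partial>Leb m) \<partial>Leb m)"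
  proof (rule nn_integral_cong)
    fix y
    have "(\<integral>\<^sup>+x. f y * b (\<lambda>j\<in>{..<m}. ?Q y j - x j) \<partial>Leb m)
        = f y * (\<integral>\<^sup>+x. b (\<lambda>j\<in>{..<m}. ?Q y j - x j) \<partial>Leb m)"
      by (rule nn_integral_cmult) measurable
    also have "(\<integral>\<^sup>+x. b (\<lambda>j\<in>{..<m}. ?Q y j - x j) \<partial>Leb m) = (\<integral>\<^sup>+x. b x \<partial>Leb m)"
      by (rule nn_integral_reflect) measurable
    finally show "(\<integral>\<^sup>+x. f y * b (\<lambda>j\<in>{..<m}. ?Q y j - x j) \<partial>Leb m) = f y * (\<integral>\<^sup>+x. b x \<partial>Leb m)" .
  qed
  also have "\<dots> = emeasure (Leb m) X * emeasure (Leb m) B"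
    by (simp add: nn_integral_multc) (simp add: f_def b_def)
  finally have eq: "emeasure (Leb m) {t \<in> space (Leb m). ?P t \<in> X} * emeasure (Leb m) B = emeasure (Leb m) X * emeasure (Leb m) B" .
  (* The ball lies between two cubes, so its volume is finite and positive. *)
  have "B \<subseteq> {..<m} \<rightarrow>\<^sub>E {-1..-1+2}"
  proof
    fix s assume s: "s \<in> B"
    have "\<bar>s j\<bar> \<le> 1" if "j < m" for j
    proof -
      have "s j * s j \<le> ip m s s" unfolding ip_def
        using member_le_sum[of j "{..<m}" "\<lambda>j. s j * s j"] that by simp
      then show ?thesis using s by (simp add: B_def abs_square_le_1[symmetric] power2_eq_square)
    qed
    then show "s \<in> {..<m} \<rightarrow>\<^sub>E {-1..-1+2}" using s by (auto simp: B_def space_PiM PiE_iff abs_le_iff)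
  qed
  then have "emeasure (Leb m) B \<le> ennreal (2 ^ m)"
    using emeasure_Leb_box[of 2 m "-1"] emeasure_mono[of B _ "Leb m", OF _ sets_Leb_box] by fastforce
  then have fin: "emeasure (Leb m) B \<noteq> \<infinity>" by (auto simp: top_unique)
  have "({..<m} \<rightarrow>\<^sub>E {0..0 + 1/real (m+1)}) \<subseteq> B"
  proof
    fix s assume s: "s \<in> {..<m} \<rightarrow>\<^sub>E {0..0 + 1/real (m+1)}"
    have "ip m s s \<le> (\<Sum>j<m. 1/real (m+1))" unfolding ip_def
    proof (intro sum_mono)
      fix j assume "j \<in> {..<m}"
      then have "0 \<le> s j" "s j \<le> 1/real (m+1)" using s by (auto simp: PiE_iff)
      moreover have "1/real (m+1) \<le> 1" by simp
      ultimately show "s j * s j \<le> 1/real (m+1)"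
        by (metis mult_left_le mult_left_mono order_trans)
    qed
    also have "\<dots> < 1" by (simp add: field_simps)
    finally show "s \<in> B" using s by (auto simp: B_def space_PiM PiE_iff)
  qed
  then have "ennreal ((1/real (m+1)) ^ m) \<le> emeasure (Leb m) B"
    using emeasure_mono[OF _ \<open>B \<in> sets (Leb m)\<close>]
    by (subst emeasure_Leb_box[of "1/real (m+1)" m 0, symmetric]) (simp, blast)
  moreover have "0 < ennreal ((1/real (m+1)) ^ m)" by simp
  ultimately have "emeasure (Leb m) B \<noteq> 0"
    by (metis leD)
  with eq fin show ?thesis
    by (simp add: ennreal_mult_cancel_left mult.commute[of _ "emeasure (Leb m) B"])
qed

text \<open>
  Back substitution. The inverse matrix is needed to see that the image of a measurable set under a
  triangular map is measurable.
\<close>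

lemma triangular_system_inverse:
  fixes R :: "nat \<Rightarrow> nat \<Rightarrow> real"
  assumes "\<And>j. j < m \<Longrightarrow> R j j \<noteq> 0"
  shows "\<exists>D. \<forall>x s. (\<forall>j<m. x j = (\<Sum>i\<in>{j..<m}. s i * R i j)) \<longleftrightarrow> (\<forall>j<m. s j = (\<Sum>i<m. x i * D i j))"
  using assms
proof (induction m)
  case 0
  then show ?case by simp
next
  case (Suc m)
  then obtain D where D: "\<And>x s. (\<forall>j<m. x j = (\<Sum>i\<in>{j..<m}. s i * R i j)) \<longleftrightarrow> (\<forall>j<m. s j = (\<Sum>i<m. x i * D i j))"
    by auto
  have Rm: "R m m \<noteq> 0" using Suc.prems by simp
  define D' where "D' i j = (if i < m then (if j < m then D i j else 0)
      else if j < m then - (\<Sum>k<m. R m k / R m m * D k j) else 1 / R m m)" for i j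
  have "(\<forall>j<Suc m. x j = (\<Sum>i\<in>{j..<Suc m}. s i * R i j)) \<longleftrightarrow> (\<forall>j<Suc m. s j = (\<Sum>i<Suc m. x i * D' i j))"
    for x s :: "nat \<Rightarrow> real"
  proof -
    have "(\<forall>j<Suc m. x j = (\<Sum>i\<in>{j..<Suc m}. s i * R i j))
      \<longleftrightarrow> s m = x m / R m m \<and> (\<forall>j<m. x j - x m / R m m * R m j = (\<Sum>i\<in>{j..<m}. s i * R i j))"
      (is "?L \<longleftrightarrow> ?M")
    proof -
      have "?L \<longleftrightarrow> x m = s m * R m m \<and> (\<forall>j<m. x j - s m * R m j = (\<Sum>i\<in>{j..<m}. s i * R i j))"
        by (auto simp: less_Suc_eq algebra_simps)
      also have "x m = s m * R m m \<longleftrightarrow> s m = x m / R m m"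
        using Rm by (auto simp: field_simps)
      also have "(s m = x m / R m m \<and> (\<forall>j<m. x j - s m * R m j = (\<Sum>i\<in>{j..<m}. s i * R i j))) \<longleftrightarrow> ?M"
        by (intro conj_cong refl) simp
      finally show ?thesis .
    qed
    also have "\<dots> \<longleftrightarrow> s m = x m / R m m \<and> (\<forall>j<m. s j = (\<Sum>i<m. (x i - x m / R m m * R m i) * D i j))"
      using D[of "\<lambda>j. x j - x m / R m m * R m j" s] by simp
    also have "\<dots> \<longleftrightarrow> s m = x m / R m m \<and> (\<forall>j<m. s j = (\<Sum>i<Suc m. x i * D' i j))"
      by (simp add: D'_def left_diff_distrib sum_subtractf sum_distrib_left mult.assoc)
    also have "\<dots> \<longleftrightarrow> (\<forall>j<Suc m. s j = (\<Sum>i<Suc m. x i * D' i j))"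
      by (auto simp: less_Suc_eq D'_def)
    finally show ?thesis .
  qed
  then show ?case by blast
qed

lemma triangular_image:
  fixes R :: "nat \<Rightarrow> nat \<Rightarrow> real" and a :: "nat \<Rightarrow> real"
  assumes R: "\<And>j. j < m \<Longrightarrow> R j j \<noteq> 0" and X: "X \<in> sets (Leb m)"
  defines "T \<equiv> \<lambda>s. \<lambda>j\<in>{..<m}. a j + (\<Sum>i\<in>{j..<m}. s i * R i j)"
  shows "T ` X \<in> sets (Leb m)"
    and "emeasure (Leb m) (T ` X) = emeasure (Leb m) X * ennreal (\<Prod>j<m. \<bar>R j j\<bar>)"
proof -
  obtain D where D: "\<And>x s. (\<forall>j<m. x j = (\<Sum>i\<in>{j..<m}. s i * R i j)) \<longleftrightarrow> (\<forall>j<m. s j = (\<Sum>i<m. x i * D i j))"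
    using triangular_system_inverse[of m R] R by blast
  define S where "S x = (\<lambda>j\<in>{..<m}. \<Sum>i<m. (x i - a i) * D i j)" for x
  have Xs: "X \<subseteq> space (Leb m)" using X by (rule sets.sets_into_space)
  have iff: "x = T s \<longleftrightarrow> s = S x" if "x \<in> space (Leb m)" "s \<in> space (Leb m)" for x s
  proof -
    have "x = T s \<longleftrightarrow> (\<forall>j<m. x j = a j + (\<Sum>i\<in>{j..<m}. s i * R i j))"
      using that by (auto simp: T_def space_PiM PiE_def extensional_def fun_eq_iff)
    also have "\<dots> \<longleftrightarrow> (\<forall>j<m. x j - a j = (\<Sum>i\<in>{j..<m}. s i * R i j))" by (auto simp: algebra_simps)
    also have "\<dots> \<longleftrightarrow> (\<forall>j<m. s j = (\<Sum>i<m. (x i - a i) * D i j))" by (rule D)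
    also have "\<dots> \<longleftrightarrow> s = S x"
      using that by (auto simp: S_def space_PiM PiE_def extensional_def fun_eq_iff)
    finally show ?thesis .
  qed
  have Ts: "T s \<in> space (Leb m)" "S s \<in> space (Leb m)" for s by (auto simp: T_def S_def space_PiM)
  have im: "T ` X = {x \<in> space (Leb m). S x \<in> X}"
    using iff Ts Xs by (auto simp: image_iff) (metis subsetD)+
  have "S \<in> measurable (Leb m) (Leb m)" unfolding S_def by measurable
  then show meas: "T ` X \<in> sets (Leb m)"
    unfolding im using X by measurable
  have "emeasure (Leb m) (T ` X) = (\<integral>\<^sup>+s. indicator (T ` X) s \<partial>Leb m)"
    using meas by simp
  also have "\<dots> = (\<integral>\<^sup>+s. indicator (T ` X) (T s) \<partial>Leb m) * ennreal (\<Prod>j<m. \<bar>R j j\<bar>)"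
    unfolding T_def by (rule nn_integral_triangular[symmetric]) (use meas R in \<open>auto simp: T_def\<close>)
  also have "(\<integral>\<^sup>+s. indicator (T ` X) (T s) \<partial>Leb m) = (\<integral>\<^sup>+s. indicator X s \<partial>Leb m :: ennreal)"
  proof (rule nn_integral_cong)
    fix s assume s: "s \<in> space (Leb m)"
    have "S (T s) = s" using iff[OF Ts(1)[of s] s] by simp
    then have "T s \<in> T ` X \<longleftrightarrow> s \<in> X"
      unfolding im by (simp add: Ts)
    then show "indicator (T ` X) (T s) = (indicator X s :: ennreal)" by (simp add: indicator_def)
  qed
  finally show "emeasure (Leb m) (T ` X) = emeasure (Leb m) X * ennreal (\<Prod>j<m. \<bar>R j j\<bar>)"
    using X by simp
qed

lemma coordinate_hyperplane_null:
  assumes "j < m"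
  shows "{x \<in> space (Leb m). x j = c} \<in> sets (Leb m)" "emeasure (Leb m) {x \<in> space (Leb m). x j = c} = 0"
proof -
  have eq: "{x \<in> space (Leb m). x j = c} = (\<Pi>\<^sub>E i\<in>{..<m}. if i = j then {c} else UNIV)"
  proof (rule set_eqI)
    fix x
    have "(\<forall>i\<in>{..<m}. x i \<in> (if i = j then {c} else UNIV)) \<longleftrightarrow> x j = c"
      using assms by (metis UNIV_I lessThan_iff singletonD singletonI)
    then show "x \<in> {x \<in> space (Leb m). x j = c}
        \<longleftrightarrow> x \<in> (\<Pi>\<^sub>E i\<in>{..<m}. if i = j then {c} else UNIV)"
      unfolding mem_Collect_eq space_PiM PiE_iff by (simp add: conj_commute)
  qed
  show "{x \<in> space (Leb m). x j = c} \<in> sets (Leb m)"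
    unfolding eq by (intro sets_PiM_I_finite) auto
  have "emeasure (Leb m) {x \<in> space (Leb m). x j = c}
      = (\<Prod>i<m. emeasure lborel (if i = j then {c} else UNIV))"
    unfolding eq by (intro lborel_product.emeasure_PiM) auto
  also have "\<dots> = 0"
    using assms by (intro prod_zero) (auto intro!: bexI[of _ j])
  finally show "emeasure (Leb m) {x \<in> space (Leb m). x j = c} = 0" .
qed

section \<open>The volume of a simplex as a product of heights\<close>

definition std_simplex :: "nat \<Rightarrow> (nat \<Rightarrow> real) set" where
  "std_simplex m = {s \<in> {..<m} \<rightarrow>\<^sub>E UNIV. (\<forall>i<m. 0 \<le> s i) \<and> (\<Sum>i<m. s i) \<le> 1}"

text \<open>
  This is \<open>1 / m!\<close>.
\<close>

definition std_volume :: "nat \<Rightarrow> real" where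
  "std_volume m = measure (Leb m) (std_simplex m)"

lemma sets_std_simplex: "std_simplex m \<in> sets (Leb m)"
proof -
  have "{s \<in> space (Leb m). (\<forall>i<m. 0 \<le> s i) \<and> (\<Sum>i<m. s i) \<le> 1} \<in> sets (Leb m)"
    by measurable
  then show ?thesis by (simp add: std_simplex_def space_PiM)
qed

lemma std_simplex_subset_cube: "std_simplex m \<subseteq> {..<m} \<rightarrow>\<^sub>E {0..0 + 1}"
proof
  fix s assume s: "s \<in> std_simplex m"
  have "s i \<le> 1" if "i < m" for i
    using member_le_sum[of i "{..<m}" s] s that by (auto simp: std_simplex_def)
  then show "s \<in> {..<m} \<rightarrow>\<^sub>E {0..0 + 1}" using s by (auto simp: std_simplex_def PiE_iff)
qed

lemma emeasure_std_simplex: "emeasure (Leb m) (std_simplex m) = ennreal (std_volume m)"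
  and std_volume_le: "std_volume m \<le> 1"
proof -
  have le: "emeasure (Leb m) (std_simplex m) \<le> 1"
    using emeasure_mono[OF std_simplex_subset_cube[of m] sets_Leb_box] emeasure_Leb_box[of 1 m 0] by simp
  then show eq: "emeasure (Leb m) (std_simplex m) = ennreal (std_volume m)"
    unfolding std_volume_def by (intro emeasure_eq_ennreal_measure) (auto simp: top_unique)
  show "std_volume m \<le> 1" using le unfolding eq by simp
qed

text \<open>
  The simplex contains a cube of side \<open>1 / (d + 1)\<close>. The bound is chosen to be uniform in the
  dimensions \<open>m \<le> d\<close>, so that a single constant serves all \<open>k\<close> and \<open>l\<close>.
\<close>

lemma std_volume_ge: "m \<le> d \<Longrightarrow> (1 / real (d + 1)) ^ d \<le> std_volume m"
proof -
  assume md: "m \<le> d"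
  let ?r = "1 / real (d + 1)"
  have "({..<m} \<rightarrow>\<^sub>E {0..0 + ?r}) \<subseteq> std_simplex m"
  proof
    fix s assume s: "s \<in> {..<m} \<rightarrow>\<^sub>E {0..0 + ?r}"
    have "(\<Sum>i<m. s i) \<le> (\<Sum>i<m. ?r)" using s by (intro sum_mono) (auto simp: PiE_iff)
    also have "\<dots> \<le> 1" using md by (simp add: field_simps)
    finally show "s \<in> std_simplex m" using s by (auto simp: std_simplex_def PiE_iff)
  qed
  then have "ennreal (?r ^ m) \<le> ennreal (std_volume m)"
    using emeasure_mono[OF _ sets_std_simplex]
    by (subst emeasure_Leb_box[of ?r m 0, symmetric], simp, subst emeasure_std_simplex[symmetric], blast)
  then have "?r ^ m \<le> std_volume m"
    by (simp add: std_volume_def)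
  moreover have "?r ^ d \<le> ?r ^ m" using md by (intro power_decreasing) auto
  ultimately show ?thesis by linarith
qed

lemma std_volume_0 [simp]: "std_volume 0 = 1"
  using std_volume_ge[of 0 0] std_volume_le[of 0] by simp

lemma std_volume_pos: "0 < std_volume m"
  by (rule less_le_trans[OF _ std_volume_ge[of m m]]) auto

text \<open>
  In the orthonormal basis adapted to the edges \<open>w\<close> the simplex is the image of the standard simplex
  under a triangular map with the heights on the diagonal. If a height vanishes, the simplex lies
  in a hyperplane on which the corresponding coordinate is constant.
\<close>

lemma emeasure_simplex_coordinates:
  "emeasure (Leb m) {t \<in> {..<m} \<rightarrow>\<^sub>E UNIV. \<exists>s\<in>std_simplex m. \<forall>k<m. t k = t0 k + (\<Sum>i<m. s i * w i k)}
    = ennreal (std_volume m * (\<Prod>i<m. height m w i))" (is "emeasure _ ?A = _")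
proof -
  obtain e where e: "orthonormal m m e" and gse: "\<And>i k. i < m \<Longrightarrow> k < m \<Longrightarrow> gs m w i k = height m w i * e i k"
    using gs_adapted_frame[of m m w] by auto
  define R where "R i j = gs_coeff m w i j * height m w j" for i j
  define a where "a j = ip m t0 (e j)" for j
  define T where "T s = (\<lambda>j\<in>{..<m}. a j + (\<Sum>i\<in>{j..<m}. s i * R i j))" for s
  have Rd: "R j j = height m w j" for j by (simp add: R_def gs_coeff_def)
  have w: "ip m (w i) (e j) = (if j \<le> i then R i j else 0)" if "i < m" "j < m" for i j
  proof -
    have "ip m (w i) (e j) = ip m (\<lambda>k. \<Sum>l\<le>i. R i l * e l k) (e j)"
      using that by (intro ip_cong) (auto simp: gs_expansion[of w i _ m] gse R_def mult.assoc intro!: sum.cong)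
    also have "\<dots> = (\<Sum>l\<le>i. if l = j then R i j else 0)"
      unfolding ip_linear using that e by (intro sum.cong) (auto simp: orthonormal_ip)
    finally show ?thesis by simp
  qed
  have A: "?A = {t \<in> space (Leb m). (\<lambda>j\<in>{..<m}. ip m t (e j)) \<in> T ` std_simplex m}"
  proof -
    have "(\<forall>k<m. t k = t0 k + (\<Sum>i<m. s i * w i k)) \<longleftrightarrow> (\<lambda>j\<in>{..<m}. ip m t (e j)) = T s"
      (is "?L \<longleftrightarrow> ?R") for t s
    proof -
      let ?y = "\<lambda>k. t0 k + (\<Sum>i<m. s i * w i k)"
      have y: "ip m ?y (e j) = a j + (\<Sum>i\<in>{j..<m}. s i * R i j)" if "j < m" for j
      proof -
        have "ip m ?y (e j) = a j + (\<Sum>i<m. s i * (if j \<le> i then R i j else 0))"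
          unfolding ip_linear using that by (simp add: a_def w)
        also have "(\<Sum>i<m. s i * (if j \<le> i then R i j else 0)) = (\<Sum>i\<in>{j..<m}. s i * R i j)"
          by (rule sum.mono_neutral_cong_right) auto
        finally show ?thesis .
      qed
      have "?R \<longleftrightarrow> (\<forall>j<m. ip m t (e j) = ip m ?y (e j))"
        by (auto simp: T_def y fun_eq_iff restrict_def)
      also have "\<dots> \<longleftrightarrow> ?L"
      proof
        assume "\<forall>j<m. ip m t (e j) = ip m ?y (e j)"
        then show ?L
          using orthonormal_basis_expansion[OF e, of _ t] orthonormal_basis_expansion[OF e, of _ ?y] by auto
      next
        assume ?L
        then show "\<forall>j<m. ip m t (e j) = ip m ?y (e j)" by (auto intro: ip_cong)
      qed
      finally show ?thesis by blast
    qed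
    then show ?thesis by (auto simp: space_PiM image_iff)
  qed
  show ?thesis
  proof (cases "\<forall>j<m. height m w j \<noteq> 0")
    case True
    then have nz: "\<And>j. j < m \<Longrightarrow> R j j \<noteq> 0" by (simp add: Rd)
    have "emeasure (Leb m) ?A = emeasure (Leb m) (T ` std_simplex m)"
      unfolding A T_def
      by (intro emeasure_orthogonal_vimage[OF e] triangular_image(1)[OF nz sets_std_simplex])
    also have "\<dots> = emeasure (Leb m) (std_simplex m) * ennreal (\<Prod>j<m. \<bar>R j j\<bar>)"
      unfolding T_def by (intro triangular_image(2)[OF nz sets_std_simplex])
    also have "\<dots> = ennreal (std_volume m * (\<Prod>i<m. height m w i))"
      using std_volume_pos[of m]
      by (simp add: emeasure_std_simplex Rd ennreal_mult prod_nonneg)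
    finally show ?thesis .
  next
    case False
    then obtain j where j: "j < m" "height m w j = 0" by blast
    (* Every entry R i j of the j-th column has the factor height m w j = 0. *)
    have "T s j = a j" "T s \<in> space (Leb m)" for s
      using j by (simp_all add: T_def R_def space_PiM)
    then have "T ` std_simplex m \<subseteq> {x \<in> space (Leb m). x j = a j}"
      by blast
    then have "?A \<subseteq> {t \<in> space (Leb m). (\<lambda>j\<in>{..<m}. ip m t (e j)) \<in> {x \<in> space (Leb m). x j = a j}}"
      unfolding A by blast
    moreover have "{t \<in> space (Leb m). (\<lambda>j\<in>{..<m}. ip m t (e j)) \<in> {x \<in> space (Leb m). x j = a j}} \<in> sets (Leb m)"
    proof -
      have "(\<lambda>t. \<lambda>j\<in>{..<m}. ip m t (e j)) \<in> measurable (Leb m) (Leb m)"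
        unfolding ip_def by measurable
      with coordinate_hyperplane_null(1)[OF j(1)] show ?thesis by measurable
    qed
    ultimately have "emeasure (Leb m) ?A
        \<le> emeasure (Leb m) {t \<in> space (Leb m). (\<lambda>j\<in>{..<m}. ip m t (e j)) \<in> {x \<in> space (Leb m). x j = a j}}"
      by (rule emeasure_mono)
    also have "\<dots> = 0"
      using emeasure_orthogonal_vimage[OF e coordinate_hyperplane_null(1)[OF j(1)]] coordinate_hyperplane_null(2)[OF j(1)]
      by simp
    finally have "emeasure (Leb m) ?A = 0" by simp
    moreover have "(\<Prod>i<m. height m w i) = 0" using j by (intro prod_zero) auto
    ultimately show ?thesis by (simp only: mult_zero_right ennreal_0)
  qed
qed

lemma spanned_simplex_enum:
  fixes p :: "nat \<Rightarrow> nat \<Rightarrow> real"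
  assumes inj: "inj_on p {..m}"
  shows "spanned_simplex d (p ` {..m})
    = {(\<lambda>x\<in>{..<d}. p 0 x + (\<Sum>i<m. s i * (p (Suc i) x - p 0 x))) | s. s \<in> std_simplex m}"
proof (intro set_eqI iffI)
  have expand: "(\<Sum>q\<in>p ` {..m}. u q * q x) = u (p 0) * p 0 x + (\<Sum>i<m. u (p (Suc i)) * p (Suc i) x)" for u x
    by (simp add: sum.reindex[OF inj] sum.atMost_shift)
  have expand1: "(\<Sum>q\<in>p ` {..m}. u q) = u (p 0) + (\<Sum>i<m. u (p (Suc i)))" for u
    by (simp add: sum.reindex[OF inj] sum.atMost_shift)
  have combine: "(1 - (\<Sum>i<m. s i)) * p 0 x + (\<Sum>i<m. s i * p (Suc i) x)
      = p 0 x + (\<Sum>i<m. s i * (p (Suc i) x - p 0 x))" for s x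
    by (simp add: algebra_simps sum_subtractf sum_distrib_left)
  {
    fix y assume "y \<in> spanned_simplex d (p ` {..m})"
    then obtain u where u: "y = (\<lambda>x\<in>{..<d}. \<Sum>q\<in>p ` {..m}. u q * q x)"
        "\<forall>q\<in>p ` {..m}. 0 \<le> u q" "(\<Sum>q\<in>p ` {..m}. u q) = 1"
      by (auto simp: spanned_simplex_def)
    define s where "s = (\<lambda>i\<in>{..<m}. u (p (Suc i)))"
    have u0: "u (p 0) = 1 - (\<Sum>i<m. s i)" using u(3) unfolding expand1 by (simp add: s_def)
    have "0 \<le> u (p 0)" using u(2) by auto
    then have "s \<in> std_simplex m"
      using u(2) u0 by (auto simp: std_simplex_def s_def)
    moreover have "y = (\<lambda>x\<in>{..<d}. p 0 x + (\<Sum>i<m. s i * (p (Suc i) x - p 0 x)))"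
    proof -
      have "(\<Sum>q\<in>p ` {..m}. u q * q x) = (1 - (\<Sum>i<m. s i)) * p 0 x + (\<Sum>i<m. s i * p (Suc i) x)" for x
        unfolding expand by (simp add: u0) (simp add: s_def)
      then show ?thesis unfolding u(1) combine by simp
    qed
    ultimately show "y \<in> {(\<lambda>x\<in>{..<d}. p 0 x + (\<Sum>i<m. s i * (p (Suc i) x - p 0 x))) | s. s \<in> std_simplex m}"
      by blast
  }
  {
    fix y assume "y \<in> {(\<lambda>x\<in>{..<d}. p 0 x + (\<Sum>i<m. s i * (p (Suc i) x - p 0 x))) | s. s \<in> std_simplex m}"
    then obtain s where s: "s \<in> std_simplex m"
        "y = (\<lambda>x\<in>{..<d}. p 0 x + (\<Sum>i<m. s i * (p (Suc i) x - p 0 x)))" by blast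
    define c where "c i = (case i of 0 \<Rightarrow> 1 - (\<Sum>i<m. s i) | Suc i \<Rightarrow> s i)" for i
    define u where "u q = c (inv_into {..m} p q)" for q
    have u: "u (p i) = c i" if "i \<le> m" for i
      using inv_into_f_f[OF inj] that by (simp add: u_def)
    have c: "0 \<le> c i" if "i \<le> m" for i
      using s(1) that by (cases i) (auto simp: c_def std_simplex_def)
    have "(\<Sum>q\<in>p ` {..m}. u q) = 1" unfolding expand1 by (simp add: u) (simp add: c_def)
    moreover have "\<forall>q\<in>p ` {..m}. 0 \<le> u q" using u c by auto
    moreover have "y = (\<lambda>x\<in>{..<d}. \<Sum>q\<in>p ` {..m}. u q * q x)"
    proof -
      have "(\<Sum>q\<in>p ` {..m}. u q * q x) = (1 - (\<Sum>i<m. s i)) * p 0 x + (\<Sum>i<m. s i * p (Suc i) x)" for x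
        unfolding expand by (simp add: u) (simp add: c_def)
      then show ?thesis unfolding s(2) combine by simp
    qed
    ultimately show "y \<in> spanned_simplex d (p ` {..m})"
      unfolding spanned_simplex_def by blast
  }
qed

lemma vertex_in_spanned_simplex:
  assumes "finite K" "q \<in> K" "q \<in> {..<d} \<rightarrow>\<^sub>E UNIV"
  shows "q \<in> spanned_simplex d K"
proof -
  have "(\<Sum>r\<in>K. (if r = q then 1 else 0) * r x) = q x" for x
  proof -
    have "(\<Sum>r\<in>K. (if r = q then 1 else 0) * r x) = (\<Sum>r\<in>K. if r = q then q x else 0)"
      by (intro sum.cong) auto
    then show ?thesis using assms by simp
  qed
  then have "q = (\<lambda>x\<in>{..<d}. \<Sum>r\<in>K. (if r = q then 1 else 0) * r x)"
    using assms(3) by (auto simp: PiE_def extensional_restrict)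
  then show ?thesis
    using assms(1,2) unfolding spanned_simplex_def
    by (intro CollectI exI[of _ "\<lambda>r. if r = q then 1 else 0"]) simp
qed

lemma orthonormal_coordinates_unique:
  assumes e: "orthonormal d m e" and eq: "\<And>x. x < d \<Longrightarrow> (\<Sum>j<m. a j * e j x) = (\<Sum>j<m. b j * e j x)" and k: "k < m"
  shows "a k = b k"
proof -
  have *: "ip d (\<lambda>x. \<Sum>j<m. c j * e j x) (e k) = c k" for c
  proof -
    have "ip d (\<lambda>x. \<Sum>j<m. c j * e j x) (e k) = (\<Sum>j<m. if j = k then c k else 0)"
      unfolding ip_linear using e k by (intro sum.cong) (auto simp: orthonormal_ip)
    then show ?thesis using k by simp
  qed
  have "ip d (\<lambda>x. \<Sum>j<m. a j * e j x) (e k) = ip d (\<lambda>x. \<Sum>j<m. b j * e j x) (e k)"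
    using eq by (intro ip_cong) auto
  then show ?thesis by (simp only: *)
qed

text \<open>
  \<open>flat_volume\<close> picks an arbitrary frame, which is meaningful only if there is one. The base point
  is the vertex \<open>p 0\<close> and the directions come from the Gram-Schmidt process; this also covers
  degenerate simplices, which lie in many \<open>m\<close>-dimensional flats.
\<close>

lemma flat_frame_exists:
  fixes p :: "nat \<Rightarrow> nat \<Rightarrow> real"
  assumes inj: "inj_on p {..m}" and md: "m \<le> d"
  shows "\<exists>F. flat_frame d m (spanned_simplex d (p ` {..m})) F"
proof -
  define v where "v i x = p (Suc i) x - p 0 x" for i x
  obtain e where e: "orthonormal d d e" and gse: "\<And>i x. i < m \<Longrightarrow> x < d \<Longrightarrow> gs d v i x = height d v i * e i x"
    using gs_adapted_frame[OF md, of v] by auto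
  define R where "R i j = (if j \<le> i then gs_coeff d v i j * height d v j else 0)" for i j
  have v: "v i x = (\<Sum>j<m. R i j * e j x)" if "i < m" "x < d" for i x
  proof -
    have "v i x = (\<Sum>j\<le>i. R i j * e j x)"
      unfolding gs_expansion[of v i x d] using that by (intro sum.cong) (auto simp: gse R_def)
    also have "\<dots> = (\<Sum>j<m. R i j * e j x)"
      using that by (intro sum.mono_neutral_left) (auto simp: R_def)
    finally show ?thesis .
  qed
  have "y \<in> flat_map d m (p 0, e) ` ({..<m} \<rightarrow>\<^sub>E UNIV)" if y_in: "y \<in> spanned_simplex d (p ` {..m})" for y
  proof -
    obtain s where "y = (\<lambda>x\<in>{..<d}. p 0 x + (\<Sum>i<m. s i * (p (Suc i) x - p 0 x)))"
      using y_in unfolding spanned_simplex_enum[OF inj] by (elim CollectE exE conjE)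
    then have y: "y = (\<lambda>x\<in>{..<d}. p 0 x + (\<Sum>i<m. s i * v i x))"
      by (simp add: v_def)
    define t where "t = (\<lambda>j\<in>{..<m}. \<Sum>i<m. s i * R i j)"
    have "(\<Sum>i<m. s i * v i x) = (\<Sum>j<m. t j * e j x)" if "x < d" for x
    proof -
      have "(\<Sum>i<m. s i * v i x) = (\<Sum>i<m. \<Sum>j<m. s i * R i j * e j x)"
        using that by (simp add: v sum_distrib_left mult.assoc)
      also have "\<dots> = (\<Sum>j<m. t j * e j x)"
        by (subst sum.swap) (simp add: t_def sum_distrib_right)
      finally show ?thesis .
    qed
    then have "y = flat_map d m (p 0, e) t"
      unfolding y flat_map_def by (auto intro!: restrict_ext)
    then show ?thesis by (auto simp: t_def)
  qed
  moreover have "orthonormal d m e" using e md by (auto simp: orthonormal_def)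
  ultimately show ?thesis unfolding flat_frame_def by (intro exI[of _ "(p 0, e)"]) auto
qed

text \<open>
  The computation takes place in the coordinates of whatever frame was chosen. The choice does not
  matter because heights are invariant under isometries.
\<close>

theorem simplex_volume_eq_heights:
  fixes p :: "nat \<Rightarrow> nat \<Rightarrow> real"
  assumes inj: "inj_on p {..m}" and md: "m \<le> d" and p: "\<And>i. i \<le> m \<Longrightarrow> p i \<in> {..<d} \<rightarrow>\<^sub>E UNIV"
  shows "simplex_volume d (p ` {..m})
    = ennreal (std_volume m * (\<Prod>i<m. height d (\<lambda>i x. p (Suc i) x - p 0 x) i))"
proof -
  let ?S = "spanned_simplex d (p ` {..m})"
  define F where "F = (SOME F. flat_frame d m ?S F)"
  have F: "flat_frame d m ?S F"
    unfolding F_def by (rule someI_ex[OF flat_frame_exists[OF inj md]])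
  obtain a e where Fae: "F = (a, e)" by (cases F)
  have e: "orthonormal d m e" and S: "?S \<subseteq> flat_map d m F ` ({..<m} \<rightarrow>\<^sub>E UNIV)"
    using F by (auto simp: flat_frame_def Fae)
  have "\<exists>t. p i = flat_map d m F t" if "i \<le> m" for i
    using S vertex_in_spanned_simplex[of "p ` {..m}" "p i" d] p[OF that] that by auto
  then obtain t where t: "\<And>i. i \<le> m \<Longrightarrow> p i = flat_map d m F (t i)" by metis
  have px: "p i x = a x + (\<Sum>j<m. t i j * e j x)" if "i \<le> m" "x < d" for i x
    using t[OF that(1)] that by (simp add: flat_map_def Fae)
  define v where "v = (\<lambda>i x. p (Suc i) x - p 0 x)"
  define w where "w i j = t (Suc i) j - t 0 j" for i j
  have v: "v i x = (\<Sum>j<m. w i j * e j x)" if "i < m" "x < d" for i x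
    using that by (simp add: v_def w_def px left_diff_distrib sum_subtractf)
  have flat: "flat_map d m F t' = (\<lambda>x\<in>{..<d}. p 0 x + (\<Sum>i<m. s i * v i x))
      \<longleftrightarrow> (\<forall>k<m. t' k = t 0 k + (\<Sum>i<m. s i * w i k))" for t' s
  proof -
    have "p 0 x + (\<Sum>i<m. s i * v i x) = a x + (\<Sum>j<m. (t 0 j + (\<Sum>i<m. s i * w i j)) * e j x)" if "x < d" for x
    proof -
      have "(\<Sum>i<m. s i * v i x) = (\<Sum>i<m. \<Sum>j<m. s i * w i j * e j x)"
        using that by (simp add: v sum_distrib_left mult.assoc)
      also have "\<dots> = (\<Sum>j<m. (\<Sum>i<m. s i * w i j) * e j x)"
        by (subst sum.swap) (simp add: sum_distrib_right)
      finally show ?thesis using that by (simp add: px distrib_right sum.distrib)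
    qed
    then have "flat_map d m F t' = (\<lambda>x\<in>{..<d}. p 0 x + (\<Sum>i<m. s i * v i x))
      \<longleftrightarrow> (\<forall>x<d. (\<Sum>j<m. t' j * e j x) = (\<Sum>j<m. (t 0 j + (\<Sum>i<m. s i * w i j)) * e j x))"
      by (auto simp: flat_map_def Fae fun_eq_iff restrict_def)
    also have "\<dots> \<longleftrightarrow> (\<forall>k<m. t' k = t 0 k + (\<Sum>i<m. s i * w i k))"
      using orthonormal_coordinates_unique[OF e, of t' "\<lambda>j. t 0 j + (\<Sum>i<m. s i * w i j)"]
      by auto
    finally show ?thesis .
  qed
  have "card (p ` {..m}) = m + 1" using card_image[OF inj] by simp
  then have "simplex_volume d (p ` {..m}) = emeasure (Leb m) {t \<in> {..<m} \<rightarrow>\<^sub>E UNIV. flat_map d m F t \<in> ?S}"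
    unfolding simplex_volume_def flat_volume_def by (simp add: F_def)
  also have "{t \<in> {..<m} \<rightarrow>\<^sub>E UNIV. flat_map d m F t \<in> ?S}
      = {t' \<in> {..<m} \<rightarrow>\<^sub>E UNIV. \<exists>s\<in>std_simplex m. \<forall>k<m. t' k = t 0 k + (\<Sum>i<m. s i * w i k)}"
    unfolding spanned_simplex_enum[OF inj] flat[symmetric] v_def by blast
  also have "emeasure (Leb m) \<dots> = ennreal (std_volume m * (\<Prod>i<m. height m w i))"
    by (rule emeasure_simplex_coordinates)
  also have "(\<Prod>i<m. height m w i) = (\<Prod>i<m. height d v i)"
    using v by (intro prod.cong refl height_isometry[OF e, symmetric]) auto
  finally show ?thesis by (simp add: v_def)
qed

section \<open>Bounds on the Heilbronn quantity and its positivity\<close>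

text \<open>
  The condition on \<open>\<delta>\<close> in the definition of \<open>heilbronn\<close>.
\<close>

definition always_thin :: "nat \<Rightarrow> nat \<Rightarrow> nat \<Rightarrow> ennreal \<Rightarrow> bool" where
  "always_thin m d n \<delta> \<longleftrightarrow>
     (\<forall>P. P \<subseteq> cube d \<and> finite P \<and> card P = n \<longrightarrow> (\<exists>K. K \<subseteq> P \<and> card K = m \<and> simplex_volume d K \<le> \<delta>))"

lemma heilbronn_upper:
  assumes "2 \<le> m" "m \<le> n" "0 < \<delta>" "always_thin m d n \<delta>"
  shows "heilbronn m d n \<le> \<delta>"
  using assms by (auto simp: heilbronn_def always_thin_def intro!: Inf_lower)

text \<open>
  For \<open>m = 1\<close> the value is 1 by convention and not the infimum, which may be smaller: in dimension 0
  the condition \<open>always_thin 1 0 n \<delta>\<close> is vacuous for \<open>n \<ge> 2\<close>. The additional hypothesis \<open>1 \<le> \<delta>\<close>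
  makes the rule uniform in \<open>m\<close>.
\<close>

lemma heilbronn_greatest:
  assumes "1 \<le> m" "m \<le> n" "\<And>\<delta>. 0 < \<delta> \<Longrightarrow> (m = 1 \<Longrightarrow> 1 \<le> \<delta>) \<Longrightarrow> always_thin m d n \<delta> \<Longrightarrow> y \<le> \<delta>"
  shows "y \<le> heilbronn m d n"
proof (cases "m = 1")
  case True
  have "always_thin 1 d n 1"
    unfolding always_thin_def
  proof (intro allI impI)
    fix P assume P: "P \<subseteq> cube d \<and> finite P \<and> card P = n"
    then obtain p where "p \<in> P" using True assms(2) by fastforce
    moreover have "p \<in> {..<d} \<rightarrow>\<^sub>E UNIV" using \<open>p \<in> P\<close> P by (auto simp: cube_def PiE_iff)
    ultimately show "\<exists>K\<subseteq>P. card K = 1 \<and> simplex_volume d K \<le> 1"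
      by (intro exI[of _ "{p}"]) (auto simp: simplex_volume_singleton)
  qed
  with assms(3)[of 1] True have "y \<le> 1" by simp
  then show ?thesis using assms(2) True by (simp add: heilbronn_def)
next
  case False
  then show ?thesis using assms
    by (auto simp: heilbronn_def always_thin_def intro!: Inf_greatest)
qed

definition moment_point :: "nat \<Rightarrow> real \<Rightarrow> nat \<Rightarrow> real" where
  "moment_point d t = (\<lambda>x\<in>{..<d}. t ^ Suc x)"

text \<open>
  A vanishing height is an affine dependence between points of the moment curve in which the last
  point has coefficient 1. Such a dependence holds for the values of every polynomial of degree at
  most \<open>d\<close> at the parameters; the polynomial whose roots are the earlier parameters contradicts it.
\<close>

lemma moment_curve_heights_nonzero:
  assumes inj: "inj_on t {..m}" and md: "m \<le> d" and i: "i < m"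
  shows "height d (\<lambda>i x. moment_point d (t (Suc i)) x - moment_point d (t 0) x) i \<noteq> 0"
proof
  define v where "v = (\<lambda>i x. moment_point d (t (Suc i)) x - moment_point d (t 0) x)"
  assume "height d (\<lambda>i x. moment_point d (t (Suc i)) x - moment_point d (t 0) x) i = 0"
  then have "height d v i = 0" by (simp add: v_def)
  then have z: "gs d v i x = 0" if "x < d" for x
    using that by (simp add: height_def ip_self_eq_0_iff)
  obtain b where b: "\<And>x. gs d v i x = v i x - (\<Sum>j<i. b j * v j x)"
    using gs_combination by blast
  have mono: "(t (Suc i) ^ x - t 0 ^ x) = (\<Sum>j<i. b j * (t (Suc j) ^ x - t 0 ^ x))" if "x \<le> d" for x
  proof (cases x)
    case 0 then show ?thesis by simp
  next
    case (Suc x')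
    then have "x' < d" using that by simp
    then show ?thesis using z[of x'] b[of x'] Suc by (simp add: v_def moment_point_def)
  qed
  define f where "f = (\<Prod>j\<le>i. [:- t j, 1:])"
  have deg: "degree f \<le> d"
  proof -
    have "degree f \<le> (\<Sum>j\<le>i. degree [:- t j, 1:])"
      using degree_prod_sum_le[of "{..i}" "\<lambda>j. [:- t j, 1:]"] by (simp add: f_def)
    also have "\<dots> \<le> d" using i md by simp
    finally show ?thesis .
  qed
  have f: "poly f r - poly f r0 = (\<Sum>x\<le>degree f. coeff f x * (r ^ x - r0 ^ x))" for r r0
    by (simp add: poly_altdef right_diff_distrib sum_subtractf)
  have "poly f (t (Suc i)) - poly f (t 0) = (\<Sum>x\<le>degree f. \<Sum>j<i. coeff f x * (b j * (t (Suc j) ^ x - t 0 ^ x)))"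
    unfolding f using mono deg by (intro sum.cong) (auto simp: sum_distrib_left)
  also have "\<dots> = (\<Sum>j<i. b j * (poly f (t (Suc j)) - poly f (t 0)))"
    by (subst sum.swap) (simp add: f sum_distrib_left algebra_simps)
  also have "\<dots> = 0"
  proof -
    have "poly f (t j) = 0" if "j \<le> i" for j
      using that by (auto simp: f_def poly_prod prod_zero_iff)
    then show ?thesis by (intro sum.neutral) auto
  qed
  also have "poly f (t 0) = 0" by (auto simp: f_def poly_prod prod_zero_iff)
  finally have "poly f (t (Suc i)) = 0" by simp
  then obtain j where "j \<le> i" "t (Suc i) = t j" by (auto simp: f_def poly_prod prod_zero_iff)
  then show False using inj_onD[OF inj, of "Suc i" j] i by auto
qed

text \<open>
  The \<open>n\<close> points with parameters \<open>i / n\<close> on the moment curve have finitely many \<open>m\<close>-subsets, all of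
  positive volume.
\<close>

lemma heilbronn_pos:
  assumes "1 \<le> m" "m \<le> d + 1"
  shows "0 < heilbronn m d n"
proof (cases "n < m \<or> m = 1")
  case True
  then show ?thesis by (auto simp: heilbronn_def)
next
  case False
  then have m: "2 \<le> m" "m \<le> n" using assms by auto
  define M where "M = m - 1"
  have M: "m = Suc M" "M \<le> d" "0 < d" using m assms by (auto simp: M_def)
  define T where "T = (\<lambda>i. real i / real n) ` {..<n}"
  have "inj_on (\<lambda>i. real i / real n) {..<n}" using m by (auto simp: inj_on_def)
  then have T: "card T = n" "finite T" by (auto simp: T_def card_image)
  have T01: "0 \<le> t" "t \<le> 1" if "t \<in> T" for t using that m by (auto simp: T_def)
  have injm: "inj_on (moment_point d) A" for A
  proof (rule inj_onI)
    fix a b assume "moment_point d a = moment_point d b"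
    then have "moment_point d a 0 = moment_point d b 0" by simp
    then show "a = b" using M(3) by (simp add: moment_point_def)
  qed
  define P where "P = moment_point d ` T"
  have "t ^ Suc x \<in> {0..1}" if "t \<in> T" for t x
    using T01[OF that] power_le_one[of t "Suc x"] by simp
  then have "moment_point d t \<in> cube d" if "t \<in> T" for t
    unfolding cube_def moment_point_def using that by (simp only: restrict_PiE_iff) blast
  then have P: "P \<subseteq> cube d" "finite P" "card P = n"
    using T by (auto simp: P_def card_image[OF injm])
  have pos: "0 < simplex_volume d K" if K: "K \<subseteq> P" "card K = m" for K
  proof -
    obtain U where U: "U \<subseteq> T" "K = moment_point d ` U" using K(1) unfolding P_def by (meson subset_image_iff)
    have "card U = m" using K(2) U injm by (simp add: card_image)
    then obtain t where t: "bij_betw t {0..<m} U"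
      using ex_bij_betw_nat_finite[of U] U T finite_subset by metis
    have "{0..<m} = {..M}" using M by auto
    with t have t': "inj_on t {..M}" "U = t ` {..M}" by (auto simp: bij_betw_def)
    have "K = (\<lambda>i. moment_point d (t i)) ` {..M}" using U t' by auto
    moreover have "inj_on (\<lambda>i. moment_point d (t i)) {..M}"
      using comp_inj_on[OF t'(1) injm] by (simp add: comp_def)
    ultimately have "simplex_volume d K = ennreal (std_volume M *
        (\<Prod>i<M. height d (\<lambda>i x. moment_point d (t (Suc i)) x - moment_point d (t 0) x) i))"
      using simplex_volume_eq_heights[of "\<lambda>i. moment_point d (t i)" M d] M by (simp add: moment_point_def)
    moreover have "0 < (\<Prod>i<M. height d (\<lambda>i x. moment_point d (t (Suc i)) x - moment_point d (t 0) x) i)"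
      using moment_curve_heights_nonzero[OF t'(1) M(2)] by (intro prod_pos) (simp add: less_le)
    ultimately show ?thesis using std_volume_pos[of M] by simp
  qed
  define V where "V = simplex_volume d ` {K. K \<subseteq> P \<and> card K = m}"
  have V: "finite V" "V \<noteq> {}"
  proof -
    show "finite V" using P(2) by (simp add: V_def)
    show "V \<noteq> {}" using obtain_subset_with_card_n[of m P] P m by (auto simp: V_def)
  qed
  have "Min V \<le> heilbronn m d n"
  proof (rule heilbronn_greatest)
    fix \<delta> assume "always_thin m d n \<delta>"
    then obtain K where K: "K \<subseteq> P" "card K = m" "simplex_volume d K \<le> \<delta>"
      using P unfolding always_thin_def by blast
    then have "Min V \<le> simplex_volume d K" using V by (intro Min_le) (auto simp: V_def)
    then show "Min V \<le> \<delta>" using K by simp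
  qed (use m in auto)
  moreover have "0 < Min V" using V pos by (auto simp: V_def)
  ultimately show ?thesis by (rule less_le_trans[rotated])
qed

section \<open>Radial projection\<close>

text \<open>
  The process applied to \<open>v i\<close> yields a vector orthogonal to \<open>e j\<close> for \<open>j < s\<close>, because these
  directions are spanned by the first \<open>s\<close> vectors. Hence in the inner product that gives the squared
  height only the remaining coordinates of \<open>z\<close> survive, and Cauchy-Schwarz applies to them.
\<close>

lemma height_le_orthogonal_part:
  assumes e: "orthonormal d d e" and sd: "s \<le> d"
    and gse: "\<And>j x. j < s \<Longrightarrow> x < d \<Longrightarrow> gs d v j x = height d v j * e j x"
    and nz: "\<And>j. j < s \<Longrightarrow> height d v j \<noteq> 0"
    and si: "s \<le> i" and J: "J \<subseteq> {s..<i}"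
    and z: "\<And>x. x < d \<Longrightarrow> z x = v i x - (\<Sum>j\<in>J. b j * v j x)"
  shows "height d v i \<le> sqrt (\<Sum>j\<in>{s..<d}. (ip d z (e j))\<^sup>2)"
proof -
  let ?g = "gs d v i"
  have zero: "ip d ?g (e j) = 0" if "j < s" for j
  proof -
    have "height d v j * ip d ?g (e j) = ip d ?g (gs d v j)"
      using gse[OF that] unfolding ip_scale_right[symmetric] by (intro ip_cong) auto
    also have "\<dots> = 0" using gs_orthogonal that si by simp
    finally show ?thesis using nz[OF that] by simp
  qed
  have split: "(\<Sum>j<d. ip d ?g (e j) * f j) = (\<Sum>j\<in>{s..<d}. ip d ?g (e j) * f j)" for f
    using sd zero by (intro sum.mono_neutral_right) auto
  have hh: "height d v i * height d v i = (\<Sum>j\<in>{s..<d}. (ip d ?g (e j))\<^sup>2)"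
    using orthonormal_basis_ip[OF e, of ?g ?g] split[of "\<lambda>j. ip d ?g (e j)"]
    by (simp add: height_sq power2_eq_square)
  have hz: "height d v i * height d v i = (\<Sum>j\<in>{s..<d}. ip d ?g (e j) * ip d z (e j))"
  proof -
    have "height d v i * height d v i = ip d ?g z"
      using J by (intro height_sq_combination[OF z]) auto
    then show ?thesis using orthonormal_basis_ip[OF e, of ?g z] split by simp
  qed
  have "(height d v i * height d v i)\<^sup>2 \<le> height d v i * height d v i * (\<Sum>j\<in>{s..<d}. (ip d z (e j))\<^sup>2)"
    unfolding hz hh
    using Cauchy_Schwarz_ineq_sum[of "\<lambda>j. ip d ?g (e j)" "\<lambda>j. ip d z (e j)" "{s..<d}"]
    unfolding hz[symmetric] hh[symmetric] by simp
  then have "(height d v i)\<^sup>2 * (height d v i)\<^sup>2 \<le> (height d v i)\<^sup>2 * (\<Sum>j\<in>{s..<d}. (ip d z (e j))\<^sup>2)"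
    by (simp add: power2_eq_square)
  then have "(height d v i)\<^sup>2 \<le> (\<Sum>j\<in>{s..<d}. (ip d z (e j))\<^sup>2)"
    by (cases "height d v i = 0")
       (simp_all only: mult_le_cancel_left_pos[OF zero_less_power2[THEN iffD2]] power_zero_numeral sum_nonneg
         zero_le_power2 not_False_eq_True)
  then show ?thesis by (rule real_le_rsqrt)
qed

text \<open>
  The order-preserving enumeration of the indices different from \<open>j0\<close>.
\<close>

definition skip :: "nat \<Rightarrow> nat \<Rightarrow> nat" where
  "skip j0 j = (if j < j0 then j else Suc j)"

lemma sum_skip:
  fixes f :: "nat \<Rightarrow> 'a :: comm_monoid_add"
  assumes "j0 \<le> D"
  shows "(\<Sum>j\<le>D. f j) = f j0 + (\<Sum>x<D. f (skip j0 x))"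
proof -
  have "(\<Sum>j\<le>D. f j) = f j0 + (\<Sum>j\<in>{..D}-{j0}. f j)"
    using assms by (subst sum.remove[of _ j0]) auto
  also have "(\<Sum>j\<in>{..D}-{j0}. f j) = (\<Sum>x<D. f (skip j0 x))"
    using assms
    by (intro sum.reindex_bij_witness[of _ "skip j0" "\<lambda>j. if j < j0 then j else j - 1"])
       (auto simp: skip_def)
  finally show ?thesis .
qed

text \<open>
  Here \<open>y i\<close> is the component of \<open>v (s + i)\<close> orthogonal to the first \<open>s\<close> vectors. Divided by its
  largest coordinate, which is the one with index \<open>j0\<close>, it becomes a point of the face \<open>y j0 = 1\<close> of
  the cube \<open>[-1,1]\<^sup>D\<^sup>+\<^sup>1\<close>; the point \<open>\<rho> i\<close> is this one in the coordinates of
  \<open>[0,1]\<^sup>D\<close>, so distances are halved. An affine combination of the points \<open>\<rho> j\<close> with \<open>j < i\<close> that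
  is close to \<open>\<rho> i\<close> lifts to a linear combination of the \<open>y j\<close> close to \<open>y i\<close>: weight the vectors with
  the reciprocals of their coordinates \<open>j0\<close>. Each height thus grows by a factor of at most \<open>2 d\<close>;
  the first vector has no predecessor, and its length is bounded separately. If a coordinate \<open>j0\<close>
  is zero, the whole vector \<open>y i\<close> is zero, and so is the left-hand side.
\<close>

lemma radial_projection_heights:
  fixes d s D M :: nat and v e \<rho> :: "nat \<Rightarrow> nat \<Rightarrow> real"
  defines "y \<equiv> \<lambda>i j. ip d (v (s + i)) (e (s + j))"
  assumes e: "orthonormal d d e" and d: "d = Suc (s + D)"
    and gse: "\<And>j x. j < s \<Longrightarrow> x < d \<Longrightarrow> gs d v j x = height d v j * e j x"
    and nz: "\<And>j. j < s \<Longrightarrow> height d v j \<noteq> 0"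
    and j0: "j0 \<le> D"
    and c: "\<And>i. i \<le> M \<Longrightarrow> \<bar>y i j0\<bar> \<le> real d"
    and top: "\<And>i j. i \<le> M \<Longrightarrow> j \<le> D \<Longrightarrow> \<bar>y i j\<bar> \<le> \<bar>y i j0\<bar>"
    and \<rho>: "\<And>i x. i \<le> M \<Longrightarrow> x < D \<Longrightarrow> \<rho> i x = (y i (skip j0 x) / y i j0 + 1) / 2"
  shows "(\<Prod>i<Suc M. height d v (s + i))
    \<le> (2 * real d) ^ (M + 2) * (\<Prod>i<M. height D (\<lambda>i x. \<rho> (Suc i) x - \<rho> 0 x) i)"
proof -
  define v' where "v' = (\<lambda>i x. \<rho> (Suc i) x - \<rho> 0 x)"
  have rhs: "0 \<le> (2 * real d) ^ (M + 2) * (\<Prod>i<M. height D v' i)"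
    by (intro mult_nonneg_nonneg prod_nonneg) auto
  have shift: "(\<Sum>j\<in>{s..<d}. f j) = (\<Sum>j\<le>D. f (s + j))" for f :: "nat \<Rightarrow> real"
    unfolding d by (intro sum.reindex_bij_witness[of _ "\<lambda>j. s + j" "\<lambda>j. j - s"]) auto
  have bound: "height d v (s + i) \<le> sqrt (\<Sum>j\<le>D. (ip d z (e (s + j)))\<^sup>2)"
    if "J \<subseteq> {s..<s + i}" "\<And>x. x < d \<Longrightarrow> z x = v (s + i) x - (\<Sum>j\<in>J. b j * v j x)" for i J z b
  proof -
    have "s \<le> d" using d by simp
    then have "height d v (s + i) \<le> sqrt (\<Sum>j\<in>{s..<d}. (ip d z (e j))\<^sup>2)"
      using gse nz that by (intro height_le_orthogonal_part[OF e, of s v "s + i" J z b]) auto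
    then show ?thesis by (simp only: shift)
  qed
  have bound0: "height d v (s + i) \<le> sqrt (\<Sum>j\<le>D. (y i j)\<^sup>2)" for i
    using bound[of "{}" i "v (s + i)"] by (simp add: y_def)
  show ?thesis
  proof (cases "\<exists>i\<le>M. y i j0 = 0")
    case True
    then obtain i where i: "i \<le> M" "y i j0 = 0" by blast
    then have "y i j = 0" if "j \<le> D" for j using top[OF i(1) that] by simp
    then have "height d v (s + i) \<le> 0" using bound0[of i] by simp
    then have "height d v (s + i) = 0" using height_nonneg[of d v "s + i"] by linarith
    then have "(\<Prod>i<Suc M. height d v (s + i)) = 0" using i by (intro prod_zero) auto
    then show ?thesis using rhs unfolding v'_def by linarith
  next
    case False
    have first: "height d v (s + 0) \<le> (2 * real d)\<^sup>2"
    proof -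
      have "(\<Sum>j\<le>D. (y 0 j)\<^sup>2) \<le> (\<Sum>j\<le>D. (real d)\<^sup>2)"
      proof (rule sum_mono)
        fix j assume "j \<in> {..D}"
        then have "\<bar>y 0 j\<bar> \<le> real d" using top[of 0 j] c[of 0] by simp
        then show "(y 0 j)\<^sup>2 \<le> (real d)\<^sup>2" by (rule abs_le_square_iff[THEN iffD1, of _ "real d", simplified])
      qed
      also have "\<dots> = real (Suc D) * (real d)\<^sup>2" by simp
      also have "\<dots> \<le> (real d)\<^sup>2 * (real d)\<^sup>2"
      proof (rule mult_right_mono)
        have "real (Suc D) \<le> real d * 1" using d by simp
        also have "\<dots> \<le> real d * real d" using d by (intro mult_left_mono) auto
        finally show "real (Suc D) \<le> (real d)\<^sup>2" by (simp add: power2_eq_square)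
      qed simp
      finally have "sqrt (\<Sum>j\<le>D. (y 0 j)\<^sup>2) \<le> (real d)\<^sup>2"
        by (intro real_le_lsqrt) (auto simp: power2_eq_square sum_nonneg)
      also have "\<dots> \<le> (2 * real d)\<^sup>2" by (simp add: power2_eq_square)
      finally show ?thesis using bound0[of 0] by linarith
    qed
    have succ: "height d v (s + Suc i) \<le> 2 * real d * height D v' i" if i: "i < M" for i
    proof -
      (* The combination that realizes the height below, rewritten with affine weights beta. *)
      obtain b where b: "\<And>x. gs D v' i x = v' i x - (\<Sum>j<i. b j * v' j x)"
        using gs_combination by blast
      define \<beta> where "\<beta> j = (case j of 0 \<Rightarrow> 1 - (\<Sum>j<i. b j) | Suc j \<Rightarrow> b j)" for j
      have \<beta>1: "(\<Sum>j\<le>i. \<beta> j) = 1" by (simp add: sum.atMost_shift \<beta>_def)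
      have \<beta>: "gs D v' i x = \<rho> (Suc i) x - (\<Sum>j\<le>i. \<beta> j * \<rho> j x)" for x
        using b[of x] unfolding sum.atMost_shift
        by (simp add: v'_def \<beta>_def right_diff_distrib left_diff_distrib sum_subtractf sum_distrib_right)
      define C where "C = y (Suc i) j0"
      have c0: "y j j0 \<noteq> 0" if "j \<le> M" for j using False that by blast
      have y\<rho>: "y j (skip j0 x) = y j j0 * (2 * \<rho> j x - 1)" if "j \<le> M" "x < D" for j x
        using that c0[of j] by (simp add: \<rho> field_simps)
      (* Lifting of the affine combination: the coordinate j0 of z cancels since the weights sum to 1. *)
      define z where "z x = v (s + Suc i) x - (\<Sum>j\<le>i. \<beta> j * C / y j j0 * v (s + j) x)" for x
      have zz: "z x = v (s + Suc i) x - (\<Sum>j\<in>{s..<s + Suc i}. \<beta> (j - s) * C / y (j - s) j0 * v j x)" for x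
        unfolding z_def
        by (intro arg_cong2[where f = "(-)"] refl
            sum.reindex_bij_witness[of _ "\<lambda>j. j - s" "\<lambda>j. s + j"]) auto
      have ipz: "ip d z (e (s + k)) = y (Suc i) k - (\<Sum>j\<le>i. \<beta> j * C / y j j0 * y j k)" for k
        unfolding z_def ip_linear y_def by simp
      have z0: "ip d z (e (s + j0)) = 0"
      proof -
        have "(\<Sum>j\<le>i. \<beta> j * C / y j j0 * y j j0) = (\<Sum>j\<le>i. \<beta> j * C)"
          using c0 i by (intro sum.cong) auto
        also have "\<dots> = C" using \<beta>1 by (simp add: sum_distrib_right[symmetric])
        finally show ?thesis unfolding ipz C_def by simp
      qed
      have zs: "ip d z (e (s + skip j0 x)) = 2 * C * gs D v' i x" if x: "x < D" for x
      proof -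
        have "(\<Sum>j\<le>i. \<beta> j * C / y j j0 * y j (skip j0 x)) = (\<Sum>j\<le>i. 2 * C * (\<beta> j * \<rho> j x) - \<beta> j * C)"
          using c0 i x by (intro sum.cong) (auto simp: y\<rho> algebra_simps)
        also have "\<dots> = 2 * C * (\<Sum>j\<le>i. \<beta> j * \<rho> j x) - C"
          using \<beta>1 by (simp add: sum_subtractf sum_distrib_left[symmetric] sum_distrib_right[symmetric])
        finally show ?thesis
          unfolding ipz \<beta> using i x by (simp add: y\<rho> C_def algebra_simps)
      qed
      have "(\<Sum>j\<le>D. (ip d z (e (s + j)))\<^sup>2) = (\<Sum>x<D. (2 * C * gs D v' i x)\<^sup>2)"
        unfolding sum_skip[OF j0] using z0 zs by simp
      also have "\<dots> = (2 * C)\<^sup>2 * (height D v' i)\<^sup>2"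
        by (simp add: power_mult_distrib sum_distrib_left[symmetric] height_def ip_def power2_eq_square[symmetric] sum_nonneg)
      finally have "sqrt (\<Sum>j\<le>D. (ip d z (e (s + j)))\<^sup>2) = \<bar>2 * C\<bar> * height D v' i"
        by (simp add: real_sqrt_mult abs_mult)
      moreover have "height d v (s + Suc i) \<le> sqrt (\<Sum>j\<le>D. (ip d z (e (s + j)))\<^sup>2)"
        by (rule bound[of "{s..<s + Suc i}", OF _ zz]) auto
      moreover have "\<bar>2 * C\<bar> * height D v' i \<le> 2 * real d * height D v' i"
        using c[of "Suc i"] i by (intro mult_right_mono) (auto simp: C_def)
      ultimately show ?thesis by linarith
    qed
    have "(\<Prod>i<Suc M. height d v (s + i)) = height d v (s + 0) * (\<Prod>i<M. height d v (s + Suc i))"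
      by (rule prod.lessThan_Suc_shift)
    also have "\<dots> \<le> (2 * real d)\<^sup>2 * (\<Prod>i<M. 2 * real d * height D v' i)"
      using first succ by (intro mult_mono prod_mono prod_nonneg conjI) auto
    also have "\<dots> = (2 * real d) ^ (M + 2) * (\<Prod>i<M. height D v' i)"
      by (simp add: prod.distrib power_add power2_eq_square)
    finally show ?thesis unfolding v'_def .
  qed
qed

section \<open>Extending a thin simplex\<close>

text \<open>
  The map \<open>\<rho>\<close> need not be injective, so the points \<open>\<rho> q\<close> may be fewer than \<open>n\<close> and
  \<open>always_thin\<close> may not apply. But then two points with the same image can be listed first, which
  makes the first height zero.
\<close>

lemma thin_tuple:
  fixes \<rho> :: "'a \<Rightarrow> nat \<Rightarrow> real"
  assumes thin: "always_thin (Suc M) D n \<delta>" and one: "M = 0 \<Longrightarrow> 1 \<le> \<delta>"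
    and MD: "M \<le> D" and Q: "finite Q" "card Q = n" "Suc M \<le> n" "\<rho> ` Q \<subseteq> cube D"
  shows "\<exists>q. inj_on q {..M} \<and> q ` {..M} \<subseteq> Q
    \<and> ennreal (std_volume M * (\<Prod>i<M. height D (\<lambda>i x. \<rho> (q (Suc i)) x - \<rho> (q 0) x) i)) \<le> \<delta>"
proof (cases "M = 0")
  case True
  then obtain q0 where "q0 \<in> Q" using Q by fastforce
  then show ?thesis using one True by (intro exI[of _ "\<lambda>_. q0"]) auto
next
  case M: False
  show ?thesis
  proof (cases "inj_on \<rho> Q")
    case True
    then have "card (\<rho> ` Q) = n" using Q by (simp add: card_image)
    then obtain K where K: "K \<subseteq> \<rho> ` Q" "card K = Suc M" "simplex_volume D K \<le> \<delta>"
      using thin Q unfolding always_thin_def by blast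
    then obtain U where U: "U \<subseteq> Q" "K = \<rho> ` U" by (meson subset_image_iff)
    have injU: "inj_on \<rho> U" using True U(1) by (rule inj_on_subset)
    then have "card U = Suc M" using K U by (simp add: card_image)
    then obtain q where q: "bij_betw q {0..<Suc M} U"
      using ex_bij_betw_nat_finite[of U] U Q finite_subset by metis
    have "{0..<Suc M} = {..M}" by auto
    with q have q': "inj_on q {..M}" "U = q ` {..M}" by (auto simp: bij_betw_def)
    have "inj_on (\<lambda>i. \<rho> (q i)) {..M}"
      using comp_inj_on[OF q'(1), of \<rho>] injU q'(2) by (simp add: comp_def)
    moreover have "\<rho> (q i) \<in> {..<D} \<rightarrow>\<^sub>E UNIV" if "i \<le> M" for i
      using Q(4) U q' that by (auto simp: cube_def PiE_iff image_subset_iff)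
    ultimately have "simplex_volume D ((\<lambda>i. \<rho> (q i)) ` {..M})
        = ennreal (std_volume M * (\<Prod>i<M. height D (\<lambda>i x. \<rho> (q (Suc i)) x - \<rho> (q 0) x) i))"
      by (intro simplex_volume_eq_heights MD)
    moreover have "(\<lambda>i. \<rho> (q i)) ` {..M} = K" using U q' by auto
    ultimately show ?thesis using K q' U by auto
  next
    case False
    then obtain a b where ab: "a \<in> Q" "b \<in> Q" "a \<noteq> b" "\<rho> a = \<rho> b" by (auto simp: inj_on_def)
    have "card (Q - {a, b}) = n - 2" using ab Q by (simp add: card_Diff_subset)
    then have "M - 1 \<le> card (Q - {a, b})" using Q(3) by linarith
    then obtain U where U: "U \<subseteq> Q - {a, b}" "card U = M - 1" "finite U"
      using obtain_subset_with_card_n by metis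
    then obtain f where f: "bij_betw f {0..<M - 1} U"
      using ex_bij_betw_nat_finite[of U] U by metis
    define q where "q i = (case i of 0 \<Rightarrow> a | Suc 0 \<Rightarrow> b | Suc (Suc j) \<Rightarrow> f j)" for i
    have fU: "f j \<in> U" if "Suc (Suc j) \<le> M" for j
      using f that by (auto simp: bij_betw_def)
    have fQ: "f j \<in> Q" if "Suc (Suc j) \<le> M" for j
      using fU[OF that] U(1) by blast
    have finj: "f j = f j' \<Longrightarrow> j = j'" if "Suc (Suc j) \<le> M" "Suc (Suc j') \<le> M" for j j'
      using f that by (auto simp: bij_betw_def inj_on_def)
    have "inj_on q {..M}"
      using fU U(1) ab(3) finj by (auto simp: inj_on_def q_def split: nat.splits)
    moreover have "q ` {..M} \<subseteq> Q"
      using fQ ab by (auto simp: q_def split: nat.splits)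
    moreover have "height D (\<lambda>i x. \<rho> (q (Suc i)) x - \<rho> (q 0) x) 0 = 0"
      using ab(4) by (simp add: height_def ip_self_eq_0_iff gs.simps[of D _ 0] q_def)
    then have "(\<Prod>i<M. height D (\<lambda>i x. \<rho> (q (Suc i)) x - \<rho> (q 0) x) i) = 0"
      using M by (intro prod_zero) (auto intro!: bexI[of _ 0])
    ultimately show ?thesis
      by (intro exI[of _ q] conjI) (simp_all only: mult_zero_right ennreal_0 zero_le)
  qed
qed

lemma enumerate_finite_set:
  assumes "finite A" "card A = Suc m"
  obtains p where "inj_on p {..m}" "A = p ` {..m}"
proof -
  obtain p where "bij_betw p {0..<card A} A" using ex_bij_betw_nat_finite[OF assms(1)] by blast
  moreover have "{0..<card A} = {..m}" using assms(2) by auto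
  ultimately show ?thesis using that by (auto simp: bij_betw_def)
qed

lemma pigeonhole_fibre:
  fixes g :: "'a \<Rightarrow> nat"
  assumes "finite A" "\<And>a. a \<in> A \<Longrightarrow> g a \<le> D" "Suc D * n \<le> card A" "0 < n"
  shows "\<exists>j\<le>D. n \<le> card {a \<in> A. g a = j}"
proof (rule ccontr)
  assume "\<not> ?thesis"
  then have small: "card {a \<in> A. g a = j} \<le> n - 1" if "j \<le> D" for j using that by fastforce
  have "A = (\<Union>j\<in>{..D}. {a \<in> A. g a = j})" using assms(2) by auto
  then have "card A \<le> (\<Sum>j\<le>D. card {a \<in> A. g a = j})"
    using card_UN_le[of "{..D}" "\<lambda>j. {a \<in> A. g a = j}"] by simp
  also have "\<dots> \<le> (\<Sum>j\<le>D. n - 1)" using small by (intro sum_mono) simp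
  also have "\<dots> = Suc D * (n - 1)" by simp
  also have "\<dots> < Suc D * n" using assms(4) by (intro mult_strict_left_mono) auto
  finally show False using assms(3) by simp
qed

text \<open>
  The list \<open>p 0, \<dots>, p s\<close> followed by the list \<open>q 0, q 1, \<dots>\<close>.
\<close>

definition join :: "nat \<Rightarrow> (nat \<Rightarrow> 'a) \<Rightarrow> (nat \<Rightarrow> 'a) \<Rightarrow> nat \<Rightarrow> 'a" where
  "join s p q i = (if i \<le> s then p i else q (i - Suc s))"

lemma join_inj_image:
  assumes "inj_on p {..s}" "inj_on q {..M}" "p ` {..s} \<inter> q ` {..M} = {}"
  shows "inj_on (join s p q) {..s + Suc M}"
    and "join s p q ` {..s + Suc M} = p ` {..s} \<union> q ` {..M}"
proof -
  show "inj_on (join s p q) {..s + Suc M}"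
  proof (rule inj_onI)
    fix i j assume ij: "i \<in> {..s + Suc M}" "j \<in> {..s + Suc M}" "join s p q i = join s p q j"
    consider "i \<le> s" "j \<le> s" | "i \<le> s" "\<not> j \<le> s" | "\<not> i \<le> s" "j \<le> s" | "\<not> i \<le> s" "\<not> j \<le> s" by blast
    then show "i = j"
    proof cases
      case 1
      then show ?thesis using ij inj_onD[OF assms(1)] by (simp add: join_def)
    next
      case 2
      then have "p i = q (j - Suc s)" "j - Suc s \<le> M" using ij by (auto simp: join_def)
      then show ?thesis using assms(3) 2 by blast
    next
      case 3
      then have "p j = q (i - Suc s)" "i - Suc s \<le> M" using ij by (auto simp: join_def)
      then show ?thesis using assms(3) 3 by blast
    next
      case 4
      then have "q (i - Suc s) = q (j - Suc s)" "i - Suc s \<le> M" "j - Suc s \<le> M" using ij by (auto simp: join_def)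
      then have "i - Suc s = j - Suc s" using inj_onD[OF assms(2)] by simp
      then show ?thesis using 4 by simp
    qed
  qed
  have "join s p q i \<in> p ` {..s} \<union> q ` {..M}" if "i \<le> s + Suc M" for i
    using that by (auto simp: join_def)
  moreover have "p i \<in> join s p q ` {..s + Suc M}" if "i \<le> s" for i
    using that by (intro image_eqI[of _ _ i]) (auto simp: join_def)
  moreover have "q i \<in> join s p q ` {..s + Suc M}" if "i \<le> M" for i
    using that by (intro image_eqI[of _ _ "Suc s + i"]) (auto simp: join_def)
  ultimately show "join s p q ` {..s + Suc M} = p ` {..s} \<union> q ` {..M}"
    by blast
qed

lemma joined_simplex_volume:
  fixes p q :: "nat \<Rightarrow> nat \<Rightarrow> real"
  assumes p: "inj_on p {..s}" and q: "inj_on q {..M}" and disj: "p ` {..s} \<inter> q ` {..M} = {}"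
    and sM: "s + Suc M \<le> d"
    and ext: "\<And>i. i \<le> s \<Longrightarrow> p i \<in> {..<d} \<rightarrow>\<^sub>E UNIV" "\<And>i. i \<le> M \<Longrightarrow> q i \<in> {..<d} \<rightarrow>\<^sub>E UNIV"
  defines "V \<equiv> \<lambda>i x. join s p q (Suc i) x - p 0 x"
  shows "simplex_volume d (p ` {..s} \<union> q ` {..M})
    = ennreal (std_volume (s + Suc M) * ((\<Prod>i<s. height d (\<lambda>i x. p (Suc i) x - p 0 x) i) * (\<Prod>i<Suc M. height d V (s + i))))"
proof -
  have split: "(\<Prod>i<s + N. f i) = (\<Prod>i<s. f i) * (\<Prod>i<N. f (s + i))" for N and f :: "nat \<Rightarrow> real"
    by (induction N) (simp_all add: mult.assoc)
  have "join s p q i \<in> {..<d} \<rightarrow>\<^sub>E UNIV" if "i \<le> s + Suc M" for i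
    using ext(1)[of i] ext(2)[of "i - Suc s"] that by (auto simp: join_def)
  then have "simplex_volume d (join s p q ` {..s + Suc M})
      = ennreal (std_volume (s + Suc M) * (\<Prod>i<s + Suc M. height d V i))"
    using simplex_volume_eq_heights[OF join_inj_image(1)[OF p q disj] sM] by (simp add: V_def join_def)
  also have "(\<Prod>i<s + Suc M. height d V i) = (\<Prod>i<s. height d V i) * (\<Prod>i<Suc M. height d V (s + i))"
    by (rule split)
  also have "(\<Prod>i<s. height d V i) = (\<Prod>i<s. height d (\<lambda>i x. p (Suc i) x - p 0 x) i)"
    by (intro prod.cong refl height_cong) (auto simp: V_def join_def)
  finally show ?thesis unfolding join_inj_image(2)[OF p q disj] .
qed

lemma ip_cube_bound:
  assumes e: "orthonormal d d e" and j: "j < d" and q: "q \<in> cube d" and p: "p \<in> cube d"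
  shows "\<bar>ip d (\<lambda>x. q x - p x) (e j)\<bar> \<le> real d"
proof -
  have "\<bar>ip d (\<lambda>x. q x - p x) (e j)\<bar> \<le> (\<Sum>x<d. \<bar>(q x - p x) * e j x\<bar>)"
    unfolding ip_def by (rule sum_abs)
  also have "\<dots> \<le> (\<Sum>x<d. 1)"
  proof (rule sum_mono)
    fix x assume x: "x \<in> {..<d}"
    have "0 \<le> q x" "q x \<le> 1" "0 \<le> p x" "p x \<le> 1" using p q x by (auto simp: cube_def PiE_iff)
    then have "\<bar>q x - p x\<bar> \<le> 1" by linarith
    moreover have "\<bar>e j x\<bar> \<le> 1"
    proof -
      have "e j x * e j x \<le> ip d (e j) (e j)" unfolding ip_def
        using member_le_sum[of x "{..<d}" "\<lambda>x. e j x * e j x"] x by simp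
      then show ?thesis using e j by (simp add: orthonormal_ip abs_square_le_1[symmetric] power2_eq_square)
    qed
    ultimately show "\<bar>(q x - p x) * e j x\<bar> \<le> 1" unfolding abs_mult by (intro mult_le_one) auto
  qed
  finally show ?thesis by simp
qed

text \<open>
  The volume of the extended simplex is split into the heights of \<open>L\<close> and the remaining ones, and the
  latter are bounded by radial projection. The exponent collects \<open>d + 1\<close> from the projection
  and twice \<open>d\<close>, for replacing the products of heights of the two small simplices by their
  volumes. If \<open>L\<close> is degenerate, every extension is.
\<close>

lemma thin_extension:
  assumes P: "P \<subseteq> cube d" "finite P"
    and L: "L \<subseteq> P" "card L = Suc s" and d: "d = Suc (s + D)" and MD: "M \<le> D"
    and n: "Suc M \<le> n" "Suc D * n \<le> card (P - L)"
    and thin: "always_thin (Suc M) D n \<delta>" and one: "M = 0 \<Longrightarrow> 1 \<le> \<delta>"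
  shows "\<exists>K. K \<subseteq> P \<and> card K = s + M + 2 \<and>
    simplex_volume d K \<le> ennreal ((2 * real (d + 1)) ^ (3 * d + 1)) * simplex_volume d L * \<delta>"
proof -
  obtain p where p: "inj_on p {..s}" "L = p ` {..s}"
    using enumerate_finite_set[of L s] L P finite_subset by metis
  define v where "v = (\<lambda>i x. p (Suc i) x - p 0 x)"
  have pc: "p i \<in> cube d" if "i \<le> s" for i using that p L P by auto
  have cube_ext: "q \<in> {..<d} \<rightarrow>\<^sub>E UNIV" if "q \<in> cube d" for q using that by (auto simp: cube_def PiE_iff)
  have volL: "simplex_volume d L = ennreal (std_volume s * (\<Prod>i<s. height d v i))"
    unfolding p(2) v_def using d pc cube_ext by (intro simplex_volume_eq_heights[OF p(1)]) auto
  have volK: "simplex_volume d (L \<union> q ` {..M})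
    = ennreal (std_volume (s + Suc M) * ((\<Prod>i<s. height d v i) * (\<Prod>i<Suc M. height d (\<lambda>i x. join s p q (Suc i) x - p 0 x) (s + i))))"
    and cardK: "card (L \<union> q ` {..M}) = s + M + 2" and subK: "L \<union> q ` {..M} \<subseteq> P"
    if q: "inj_on q {..M}" "q ` {..M} \<subseteq> P - L" for q
  proof -
    have disj: "p ` {..s} \<inter> q ` {..M} = {}" using q p by auto
    have qc: "q i \<in> cube d" if "i \<le> M" for i using that q P by auto
    show "simplex_volume d (L \<union> q ` {..M})
    = ennreal (std_volume (s + Suc M) * ((\<Prod>i<s. height d v i) * (\<Prod>i<Suc M. height d (\<lambda>i x. join s p q (Suc i) x - p 0 x) (s + i))))"
      unfolding p(2) v_def using d MD pc qc cube_ext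
      by (intro joined_simplex_volume[OF p(1) q(1) disj]) auto
    show "card (L \<union> q ` {..M}) = s + M + 2"
      using disj p(2) L(2) card_image[OF q(1)] by (subst card_Un_disjoint) auto
    show "L \<union> q ` {..M} \<subseteq> P" using q L by auto
  qed
  have fin: "finite (P - L)" using P by simp
  show ?thesis
  proof (cases "\<forall>i<s. height d v i \<noteq> 0")
    case False
    then have zero: "(\<Prod>i<s. height d v i) = 0" by (intro prod_zero) auto
    have "Suc M \<le> card (P - L)"
      using n by (metis le_trans mult_Suc le_add1)
    then obtain A where A: "A \<subseteq> P - L" "card A = Suc M" "finite A"
      using obtain_subset_with_card_n by metis
    then obtain q where q: "inj_on q {..M}" "A = q ` {..M}" using enumerate_finite_set by metis
    have "simplex_volume d (L \<union> q ` {..M}) = 0" using A q by (subst volK) (auto simp: zero)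
    moreover have "q ` {..M} \<subseteq> P - L" using A q by simp
    ultimately show ?thesis using cardK[OF q(1)] subK[OF q(1)]
      by (intro exI[of _ "L \<union> q ` {..M}"]) auto
  next
    case True
    have sd: "s \<le> d" using d by simp
    obtain e where e: "orthonormal d d e"
      and gse: "\<And>i x. i < s \<Longrightarrow> x < d \<Longrightarrow> gs d v i x = height d v i * e i x"
      using gs_adapted_frame[OF sd, of v] by auto
    define y where "y q j = ip d (\<lambda>x. q x - p 0 x) (e (s + j))" for q j
    (* The face hit by the ray through y q, with opposite faces identified. *)
    define top where "top q = (SOME j. j \<le> D \<and> (\<forall>j'\<le>D. \<bar>y q j'\<bar> \<le> \<bar>y q j\<bar>))" for q
    have top: "top q \<le> D" "j' \<le> D \<Longrightarrow> \<bar>y q j'\<bar> \<le> \<bar>y q (top q)\<bar>" for q j'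
    proof -
      have "\<exists>j. j \<le> D \<and> (\<forall>j'\<le>D. \<bar>y q j'\<bar> \<le> \<bar>y q j\<bar>)"
      proof -
        have "Max ((\<lambda>j. \<bar>y q j\<bar>) ` {..D}) \<in> (\<lambda>j. \<bar>y q j\<bar>) ` {..D}" by (intro Max_in) auto
        then obtain j where j: "Max ((\<lambda>j. \<bar>y q j\<bar>) ` {..D}) = \<bar>y q j\<bar>" "j \<in> {..D}"
          by (rule imageE)
        have "\<bar>y q j'\<bar> \<le> \<bar>y q j\<bar>" if "j' \<le> D" for j'
          unfolding j(1)[symmetric] using that by (intro Max_ge) auto
        with j(2) show ?thesis by blast
      qed
      from someI_ex[OF this] show "top q \<le> D" "j' \<le> D \<Longrightarrow> \<bar>y q j'\<bar> \<le> \<bar>y q (top q)\<bar>"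
        unfolding top_def by blast+
    qed
    obtain j0 where j0: "j0 \<le> D" "n \<le> card {q \<in> P - L. top q = j0}"
      using pigeonhole_fibre[OF fin, of top D n] top(1) n by auto
    obtain Q where Q: "Q \<subseteq> {q \<in> P - L. top q = j0}" "card Q = n" "finite Q"
      using obtain_subset_with_card_n[OF j0(2)] by blast
    (* If y q = 0, then x / 0 = 0 makes this the centre of the cube. *)
    define \<rho> where "\<rho> q = (\<lambda>x\<in>{..<D}. (y q (skip j0 x) / y q j0 + 1) / 2)" for q
    have "\<rho> q \<in> cube D" if "q \<in> Q" for q
    proof -
      have "(y q (skip j0 x) / y q j0 + 1) / 2 \<in> {0..1}" if x: "x < D" for x
      proof -
        have "\<bar>y q (skip j0 x)\<bar> \<le> \<bar>y q j0\<bar>"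
          using top(2)[of "skip j0 x" q] Q \<open>q \<in> Q\<close> x by (auto simp: skip_def)
        then have "\<bar>y q (skip j0 x) / y q j0\<bar> \<le> 1" by (auto simp: abs_divide divide_le_eq_1)
        then have "- 1 \<le> y q (skip j0 x) / y q j0" "y q (skip j0 x) / y q j0 \<le> 1"
          unfolding abs_le_iff by linarith+
        then show ?thesis by simp
      qed
      then show ?thesis unfolding \<rho>_def cube_def by (simp only: restrict_PiE_iff) blast
    qed
    then have "\<rho> ` Q \<subseteq> cube D" by auto
    from thin_tuple[OF thin one MD Q(3,2) n(1) this] obtain q where
      q: "inj_on q {..M}" "q ` {..M} \<subseteq> Q"
      "ennreal (std_volume M * (\<Prod>i<M. height D (\<lambda>i x. \<rho> (q (Suc i)) x - \<rho> (q 0) x) i)) \<le> \<delta>"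
      by blast
    have qPL: "q ` {..M} \<subseteq> P - L" using q Q by auto
    define V where "V = (\<lambda>i x. join s p q (Suc i) x - p 0 x)"
    define H where "H = (\<Prod>i<s. height d v i)"
    define H' where "H' = (\<Prod>i<M. height D (\<lambda>i x. \<rho> (q (Suc i)) x - \<rho> (q 0) x) i)"
    have Vv: "gs d V i = gs d v i" "height d V i = height d v i" if "i < s" for i
    proof -
      have "V j x = v j x" if "j \<le> i" for j x using that \<open>i < s\<close> by (simp add: V_def v_def join_def)
      then show "gs d V i = gs d v i" "height d V i = height d v i" by (simp_all cong: gs_cong height_cong)
    qed
    have yV: "y (q i) j = ip d (V (s + i)) (e (s + j))" for i j
      by (simp add: y_def V_def join_def)
    have qi: "q i \<in> P - L" "top (q i) = j0" if "i \<le> M" for i using q Q that by auto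
    have "(\<Prod>i<Suc M. height d V (s + i)) \<le> (2 * real d) ^ (M + 2) * H'"
      unfolding H'_def
    proof (rule radial_projection_heights[OF e d, where ?j0.0 = j0])
      fix i assume i: "i \<le> M"
      show "\<bar>ip d (V (s + i)) (e (s + j0))\<bar> \<le> real d"
        unfolding yV[symmetric] y_def using qi[OF i] P pc j0 d by (intro ip_cube_bound[OF e]) auto
      show "\<bar>ip d (V (s + i)) (e (s + j))\<bar> \<le> \<bar>ip d (V (s + i)) (e (s + j0))\<bar>" if "j \<le> D" for j
        unfolding yV[symmetric] using top(2)[OF that, of "q i"] qi[OF i] by simp
      show "\<rho> (q i) x = (ip d (V (s + i)) (e (s + skip j0 x)) / ip d (V (s + i)) (e (s + j0)) + 1) / 2"
        if "x < D" for x
        unfolding yV[symmetric] using that by (simp add: \<rho>_def)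
    qed (use gse True Vv j0 in auto)
    moreover have H0: "0 \<le> H" "0 \<le> H'" by (simp_all add: H_def H'_def prod_nonneg)
    ultimately have "std_volume (s + Suc M) * (H * (\<Prod>i<Suc M. height d V (s + i)))
        \<le> 1 * (H * ((2 * real d) ^ (M + 2) * H'))"
      using std_volume_le[of "s + Suc M"]
      by (intro mult_mono mult_left_mono) (auto intro!: prod_nonneg mult_nonneg_nonneg)
    also have "\<dots> \<le> (2 * real (d + 1)) ^ (3 * d + 1) * (std_volume s * H) * (std_volume M * H')"
    proof -
      let ?r = "2 * real (d + 1)"
      have "(2 * real d) ^ (M + 2) \<le> ?r ^ (M + 2)" by (intro power_mono) auto
      also have "\<dots> \<le> ?r ^ (d + 1)" using MD d by (intro power_increasing) auto
      finally have 1: "(2 * real d) ^ (M + 2) \<le> ?r ^ (d + 1)" .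
      have 2: "1 \<le> ?r ^ d * std_volume m" if "m \<le> d" for m
      proof -
        have "1 \<le> (2::real) ^ d" by simp
        also have "\<dots> = ?r ^ d * (1 / real (d + 1)) ^ d"
        proof -
          have "?r * (1 / real (d + 1)) = 2" by (simp add: field_simps)
          then show ?thesis by (metis power_mult_distrib)
        qed
        also have "\<dots> \<le> ?r ^ d * std_volume m" using std_volume_ge[OF that] by (intro mult_left_mono) auto
        finally show ?thesis .
      qed
      have "1 * 1 \<le> (?r ^ d * std_volume s) * (?r ^ d * std_volume M)"
        using 2[of s] 2[of M] d MD by (intro mult_mono) auto
      then have "?r ^ (d + 1) * 1 \<le> ?r ^ (d + 1) * ((?r ^ d * std_volume s) * (?r ^ d * std_volume M))"
        by (intro mult_left_mono) auto
      also have "\<dots> = ?r ^ (3 * d + 1) * std_volume s * std_volume M"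
      proof -
        have "3 * d + 1 = (d + 1) + d + d" by simp
        then have "?r ^ (3 * d + 1) = ?r ^ (d + 1) * ?r ^ d * ?r ^ d" by (simp only: power_add)
        then show ?thesis by (simp only: mult_ac)
      qed
      finally have "(2 * real d) ^ (M + 2) \<le> ?r ^ (3 * d + 1) * std_volume s * std_volume M"
        using 1 unfolding mult_1_right by (rule order_trans[rotated])
      then have "(2 * real d) ^ (M + 2) * (H * H') \<le> ?r ^ (3 * d + 1) * std_volume s * std_volume M * (H * H')"
        using H0 by (intro mult_right_mono) auto
      then show ?thesis by (simp only: mult_ac mult_1)
    qed
    finally have "simplex_volume d (L \<union> q ` {..M})
        \<le> ennreal ((2 * real (d + 1)) ^ (3 * d + 1) * (std_volume s * H) * (std_volume M * H'))"
      unfolding volK[OF q(1) qPL] V_def H_def by (rule ennreal_leI)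
    also have "\<dots> = ennreal ((2 * real (d + 1)) ^ (3 * d + 1)) * simplex_volume d L * ennreal (std_volume M * H')"
      unfolding volL H_def[symmetric] using H0 std_volume_pos[of s] std_volume_pos[of M]
      by (simp add: ennreal_mult'' ennreal_mult less_imp_le)
    also have "\<dots> \<le> ennreal ((2 * real (d + 1)) ^ (3 * d + 1)) * simplex_volume d L * \<delta>"
      using q(3) unfolding H'_def by (intro mult_left_mono) auto
    finally show ?thesis using cardK[OF q(1) qPL] subK[OF q(1) qPL] by blast
  qed
qed

section \<open>The inequality\<close>

lemma le_mult_if_divide_le:
  fixes a b c :: ennreal
  assumes "b \<noteq> 0" "b \<noteq> top" "a / b \<le> c"
  shows "a \<le> c * b"
proof -
  have "a = (a / b) * b" using assms(1,2) by (simp add: ennreal_divide_times top.not_eq_extremum)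
  also have "\<dots> \<le> c * b" using assms(3) by (rule mult_right_mono) simp
  finally show ?thesis .
qed

theorem theorem1p1:
  fixes d :: nat
  shows "\<exists>C::real. C > 0 \<and>
    (\<forall>k l :: nat. 2 \<le> k \<and> k \<le> d + 1 \<and> 1 \<le> l \<and> l < k \<longrightarrow>
      (\<forall>n n' :: nat. n > 0 \<and> n' > 0 \<and> real n' > C * real n \<longrightarrow>
         heilbronn k d n' \<le> ennreal C * heilbronn l d n * heilbronn (k - l) (d - l) n))"
proof -
  define C where "C = (2 * real (d + 1)) ^ (3 * d + 1)"
  (* This suffices for the pigeonhole principle on the d - l + 1 faces, after n points are set aside for L. *)
  have C: "real (2 * (d + 1)) \<le> C"
    unfolding C_def using power_increasing[of 1 "3 * d + 1" "2 * real (d + 1)"] by simp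
  then have Cpos: "0 < C" by simp
  have "heilbronn k d n' \<le> ennreal C * heilbronn l d n * heilbronn (k - l) (d - l) n"
    if kl: "2 \<le> k" "k \<le> d + 1" "1 \<le> l" "l < k" and n: "n > 0" "real n' > C * real n" for k l n n'
  proof -
    let ?a = "heilbronn l d n" and ?b = "heilbronn (k - l) (d - l) n"
    have a: "0 < ?a" using kl by (intro heilbronn_pos) auto
    have b: "0 < ?b" using kl by (intro heilbronn_pos) auto
    show ?thesis
    proof (cases "?a = \<infinity> \<or> ?b = \<infinity>")
      case True
      then show ?thesis using a b Cpos by (auto simp: ennreal_mult_top ennreal_top_mult ennreal_mult_eq_top_iff)
    next
      case fin: False
      have ln: "l \<le> n" "k - l \<le> n"
        using fin by (metis (no_types) heilbronn_def not_less)+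
      define s M D where "s = l - 1" and "M = k - l - 1" and "D = d - l"
      have sMD: "l = Suc s" "k - l = Suc M" "k = s + M + 2" "d - l = D" "d = Suc (s + D)" "M \<le> D"
        using kl by (auto simp: s_def M_def D_def)
      have big: "2 * (d + 1) * n < n'"
      proof -
        have "real (2 * (d + 1)) * real n \<le> C * real n" by (rule mult_right_mono[OF C]) simp
        then have "real (2 * (d + 1) * n) < real n'"
          using n(2) by (simp only: of_nat_mult)
        then show ?thesis by (simp only: of_nat_less_iff)
      qed
      have "Suc D * n + n = (D + 2) * n" by simp
      also have "\<dots> \<le> 2 * (d + 1) * n" using sMD(5) by (intro mult_right_mono) auto
      finally have n': "Suc D * n + n \<le> n'" using big by linarith
      moreover have "k \<le> n + n" using ln kl by linarith
      moreover have "n \<le> Suc D * n" by simp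
      ultimately have kn': "k \<le> n'" by linarith
      have main: "heilbronn k d n' \<le> ennreal C * \<delta>1 * \<delta>2"
        if \<delta>1: "0 < \<delta>1" "always_thin l d n \<delta>1"
          and \<delta>2: "0 < \<delta>2" "k - l = 1 \<Longrightarrow> 1 \<le> \<delta>2" "always_thin (k - l) (d - l) n \<delta>2" for \<delta>1 \<delta>2
      proof (rule heilbronn_upper[OF kl(1) kn'])
        show "0 < ennreal C * \<delta>1 * \<delta>2" using Cpos \<delta>1 \<delta>2 by (simp add: ennreal_zero_less_mult_iff)
        show "always_thin k d n' (ennreal C * \<delta>1 * \<delta>2)"
          unfolding always_thin_def
        proof (intro allI impI)
          fix P assume P: "P \<subseteq> cube d \<and> finite P \<and> card P = n'"
          have "n \<le> card P" using P n' by simp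
          then obtain P0 where P0: "P0 \<subseteq> P" "card P0 = n" "finite P0"
            using obtain_subset_with_card_n by metis
          then obtain L where L: "L \<subseteq> P0" "card L = l" "simplex_volume d L \<le> \<delta>1"
            using \<delta>1(2) P unfolding always_thin_def by (metis order_trans)
          have "card (P - L) = n' - l" using L P0 P by (simp add: card_Diff_subset finite_subset)
          then have "Suc D * n \<le> card (P - L)" using n' ln by linarith
          then obtain K where K: "K \<subseteq> P" "card K = s + M + 2"
              "simplex_volume d K \<le> ennreal C * simplex_volume d L * \<delta>2"
            using thin_extension[of P d L s D M n \<delta>2] P L P0 sMD ln \<delta>2 unfolding C_def by auto
          have "ennreal C * simplex_volume d L * \<delta>2 \<le> ennreal C * \<delta>1 * \<delta>2"
            using L(3) by (intro mult_right_mono mult_left_mono) auto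
          then show "\<exists>K\<subseteq>P. card K = k \<and> simplex_volume d K \<le> ennreal C * \<delta>1 * \<delta>2"
            using K sMD(3) by (intro exI[of _ K]) auto
        qed
      qed
      let ?h = "heilbronn k d n'"
      (* The two infima are taken one after the other. Division is legitimate since both factors are
         positive and finite. *)
      have "?h / (ennreal C * ?a) \<le> ?b"
      proof (rule heilbronn_greatest)
        fix \<delta>2 assume \<delta>2: "0 < \<delta>2" "k - l = 1 \<Longrightarrow> 1 \<le> \<delta>2" "always_thin (k - l) (d - l) n \<delta>2"
        show "?h / (ennreal C * ?a) \<le> \<delta>2"
        proof (cases "\<delta>2 = \<infinity>")
          case False
          have "?h / (ennreal C * \<delta>2) \<le> ?a"
          proof (rule heilbronn_greatest)
            fix \<delta>1 assume "0 < \<delta>1" "always_thin l d n \<delta>1"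
            from main[OF this \<delta>2] show "?h / (ennreal C * \<delta>2) \<le> \<delta>1"
              using Cpos \<delta>2(1) by (intro divide_le_posI_ennreal) (auto simp: ennreal_zero_less_mult_iff mult_ac)
          qed (use kl ln in auto)
          then have "?h \<le> ?a * (ennreal C * \<delta>2)"
            using Cpos \<delta>2(1) False
            by (intro le_mult_if_divide_le) (auto simp: ennreal_mult_eq_top_iff)
          then show ?thesis
            using Cpos a by (intro divide_le_posI_ennreal) (auto simp: ennreal_zero_less_mult_iff mult_ac)
        qed simp
      qed (use kl ln in auto)
      then have "?h \<le> ?b * (ennreal C * ?a)"
        using Cpos a fin by (intro le_mult_if_divide_le) (auto simp: ennreal_mult_eq_top_iff)
      then show ?thesis by (simp add: mult_ac)
    qed
  qed
  then show ?thesis using Cpos by (intro exI[of _ C]) auto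
qed

end
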